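(* For each fixed integer $k\ge 4$, $k$-Colouring Reconfiguration can be solved in time $O((k\ell)^{\ell^2+\ell}\cdot \ell n^2)$. In particular, for each fixed $k\ge 4$, $k$-Colouring Reconfiguration is fixed-parameter tractable when parameterized by $\ell$.
   Context: For a graph $G=(V,E)$ and positive integer $k$, a $k$-colouring is a map $c:V\to\{1,\dots,k\}$; it is proper if $c(u)\neq c(v)$ for every edge $uv\in E$. The reconfiguration graph $R_k(G)$ has as vertices the proper $k$-colourings of $G$, two being adjacent iff they differ on exactly one vertex. The problem $k$-Colouring Reconfiguration: given an $n$-vertex graph $G$, two proper $k$-colourings $\alpha,\beta$ of $G$ and a positive integer $\ell$, decide whether there is a path in $R_k(G)$ between $\alpha$ and $\beta$ of length at most $\ell$. A parameterized problem is fixed-parameter tractable if every instance $I$ with parameter $p$ can be solved in time $f(p)|I|^c$ for a computable function $f$ and a constant $c$ independent of $p$. *)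

theory Defs
  imports
    "HOL-Library.FuncSet"
    "HOL-Library.Log_Nat"
    "Graph_Theory.Pair_Digraph"
begin

section \<open>Random access machines\<close>

text \<open>
  A load/store random access machine in the style of Cook and Reckhow: finitely many registers are
  addressed directly by the program, and an unbounded memory is addressed indirectly. All cells hold
  natural numbers, and every instruction costs one time unit. The only arithmetic operations are
  addition and truncated subtraction. There is deliberately no multiplication: within \<open>t\<close> steps the
  bit length of a number then grows by at most \<open>t\<close>, so that the unit cost measure is polynomially
  related to Turing machine time.
\<close>

datatype instr =
    Const nat nat
  | Add nat nat nat
  | Sub nat nat nat
  | Load nat nat
  | Store nat nat
  | Jump_Zero nat nat

type_synonym ram_program = "instr list"

text \<open>A configuration consists of the program counter, the registers and the memory.\<close>

type_synonym ram_config = "nat \<times> (nat \<Rightarrow> nat) \<times> (nat \<Rightarrow> nat)"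

fun exec_instr :: "instr \<Rightarrow> ram_config \<Rightarrow> ram_config" where
  "exec_instr (Const i c) (pc, R, M) = (Suc pc, R(i := c), M)"
| "exec_instr (Add i j k) (pc, R, M) = (Suc pc, R(i := R j + R k), M)"
| "exec_instr (Sub i j k) (pc, R, M) = (Suc pc, R(i := R j - R k), M)"
| "exec_instr (Load i j) (pc, R, M) = (Suc pc, R(i := M (R j)), M)"
| "exec_instr (Store i j) (pc, R, M) = (Suc pc, R, M(R i := R j))"
| "exec_instr (Jump_Zero i l) (pc, R, M) = (if R i = 0 then l else Suc pc, R, M)"

text \<open>The machine halts when the program counter leaves the program.\<close>

definition halted :: "ram_program \<Rightarrow> ram_config \<Rightarrow> bool" where
  "halted P c \<longleftrightarrow> length P \<le> fst c"

definition ram_step :: "ram_program \<Rightarrow> ram_config \<Rightarrow> ram_config" where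
  "ram_step P c = (if halted P c then c else exec_instr (P ! fst c) c)"

definition initial_config :: "nat list \<Rightarrow> ram_config" where
  "initial_config xs = (0, \<lambda>_. 0, \<lambda>i. if i < length xs then xs ! i else 0)"

text \<open>
  Halted configurations are fixed points of \<^const>\<open>ram_step\<close>, so being halted after \<open>t\<close> iterations
  means having executed at most \<open>t\<close> instructions. The output is the content of register 0.
\<close>

definition outputs_within :: "ram_program \<Rightarrow> nat list \<Rightarrow> nat \<Rightarrow> nat \<Rightarrow> bool" where
  "outputs_within P xs y t \<longleftrightarrow>
     (let c = (ram_step P ^^ t) (initial_config xs) in halted P c \<and> fst (snd c) 0 = y)"

definition computable :: "(nat \<Rightarrow> nat) \<Rightarrow> bool" where
  "computable f \<longleftrightarrow> (\<exists>P. \<forall>x. \<exists>t. outputs_within P [x] (f x) t)"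

lemma outputs_within_mono:
  assumes "outputs_within P xs y s" and "s \<le> t"
  shows "outputs_within P xs y t"
proof -
  have "(ram_step P ^^ (d + s)) (initial_config xs) = (ram_step P ^^ s) (initial_config xs)" for d
    using assms(1) by (induction d) (auto simp: outputs_within_def Let_def ram_step_def)
  from this[of "t - s"] show ?thesis
    using assms by (simp add: outputs_within_def)
qed


section \<open>Parameterized problems\<close>

record 'i param_problem =
  instances :: "'i set"
  yes :: "'i \<Rightarrow> bool"
  encode :: "'i \<Rightarrow> nat list"
  parameter :: "'i \<Rightarrow> nat"

definition solves_in_time :: "ram_program \<Rightarrow> 'i param_problem \<Rightarrow> ('i \<Rightarrow> nat) \<Rightarrow> bool" where
  "solves_in_time P Q T \<longleftrightarrow>
     (\<forall>I \<in> instances Q. outputs_within P (encode Q I) (if yes Q I then 1 else 0) (T I))"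

text \<open>
  The size \<open>|I|\<close> of an instance is the number of bits of its encoding; 0 takes one bit.
\<close>

definition input_size :: "nat list \<Rightarrow> nat" where
  "input_size xs = (\<Sum>x\<leftarrow>xs. max 1 (floorlog 2 x))"

definition fixed_parameter_tractable :: "'i param_problem \<Rightarrow> bool" where
  "fixed_parameter_tractable Q \<longleftrightarrow>
     (\<exists>P f c. computable f \<and>
        solves_in_time P Q (\<lambda>I. f (parameter Q I) * input_size (encode Q I) ^ c))"


section \<open>Colouring reconfiguration\<close>

text \<open>
  Finite simple undirected graphs are rendered as the finite, loop-free, symmetric digraphs of
  \<^locale>\<open>pair_graph\<close>: an edge \<open>uv\<close> is the pair of arcs \<open>(u, v)\<close> and \<open>(v, u)\<close>. Colourings are
  extensional functions on the vertex set, so that equality of colourings is equality as maps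
  \<open>V \<rightarrow> {1, \<dots>, k}\<close>.
\<close>

definition colourings :: "nat \<Rightarrow> 'a pair_pre_digraph \<Rightarrow> ('a \<Rightarrow> nat) set" where
  "colourings k G = (pverts G \<rightarrow>\<^sub>E {1..k})"

definition proper_colourings :: "nat \<Rightarrow> 'a pair_pre_digraph \<Rightarrow> ('a \<Rightarrow> nat) set" where
  "proper_colourings k G = {c \<in> colourings k G. \<forall>(u, v) \<in> parcs G. c u \<noteq> c v}"

definition reconf_graph :: "nat \<Rightarrow> 'a pair_pre_digraph \<Rightarrow> ('a \<Rightarrow> nat) pair_pre_digraph" where
  "reconf_graph k G =
     \<lparr> pverts = proper_colourings k G,
       parcs = {(c, d). c \<in> proper_colourings k G \<and> d \<in> proper_colourings k G \<and>
                        (\<exists>!v. v \<in> pverts G \<and> c v \<noteq> d v)} \<rparr>"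

lemma pair_graph_reconf_graph:
  assumes "pair_graph G"
  shows "pair_graph (reconf_graph k G)"
proof -
  interpret pair_graph G by fact
  have fin: "finite (proper_colourings k G)"
    unfolding proper_colourings_def colourings_def using pair_finite_verts
    by (intro finite_Collect_conjI disjI1) (simp add: finite_PiE)
  have "parcs (reconf_graph k G) \<subseteq> proper_colourings k G \<times> proper_colourings k G"
    by (auto simp: reconf_graph_def)
  then have "finite (parcs (reconf_graph k G))"
    using fin by (meson finite_SigmaI finite_subset)
  moreover have "sym (parcs (reconf_graph k G))"
    by (rule symI) (auto simp: reconf_graph_def eq_commute)
  ultimately show ?thesis
    using fin by unfold_locales (auto simp: reconf_graph_def symmetric_def)
qed

text \<open>
  An input graph has vertex set \<open>{0, \<dots>, n - 1}\<close>.
\<close>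

record reconf_instance =
  graph :: "nat pair_pre_digraph"
  source :: "nat \<Rightarrow> nat"
  target :: "nat \<Rightarrow> nat"
  bound :: nat

definition num_vertices :: "reconf_instance \<Rightarrow> nat" where
  "num_vertices I = card (pverts (graph I))"

definition reconf_instances :: "nat \<Rightarrow> reconf_instance set" where
  "reconf_instances k =
     {I. pair_graph (graph I) \<and> pverts (graph I) = {0..<num_vertices I} \<and>
         source I \<in> proper_colourings k (graph I) \<and>
         target I \<in> proper_colourings k (graph I) \<and> 1 \<le> bound I}"

definition reconf_yes :: "nat \<Rightarrow> reconf_instance \<Rightarrow> bool" where
  "reconf_yes k I \<longleftrightarrow>
     (\<exists>p. pre_digraph.apath (with_proj (reconf_graph k (graph I))) (source I) p (target I) \<and>
          length p \<le> bound I)"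

text \<open>
  An instance is presented to the machine as \<open>n\<close>, \<open>\<ell>\<close>, the two colour vectors, and the adjacency
  matrix in row-major order; the number \<open>k\<close> of colours is not part of the input.
\<close>

definition reconf_encode :: "reconf_instance \<Rightarrow> nat list" where
  "reconf_encode I =
     [num_vertices I, bound I] @ map (source I) [0..<num_vertices I] @ map (target I) [0..<num_vertices I] @
     concat (map (\<lambda>u. map (\<lambda>v. if (u, v) \<in> parcs (graph I) then 1 else 0) [0..<num_vertices I])
       [0..<num_vertices I])"

definition colouring_reconfiguration :: "nat \<Rightarrow> reconf_instance param_problem" where
  "colouring_reconfiguration k =
     \<lparr> instances = reconf_instances k, yes = reconf_yes k, encode = reconf_encode,
       parameter = bound \<rparr>"

end

theory Submission
  imports Defs
begin

text \<open>
  Guess a schedule of \<open>l\<close> pairs (index, colour), where the index stands for the vertex that was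
  discovered at that position. Vertices are discovered by simulating the schedule from the source
  colouring: if a recolouring of \<open>u\<close> conflicts with a neighbour \<open>w\<close>, or \<open>w\<close> does not end with its
  target colour, then every recolouring sequence consistent with the schedule must recolour \<open>w\<close>, so
  \<open>w\<close> joins the list. At most \<open>l\<close> vertices are recoloured, so \<open>l + 1\<close> passes reach a pass that
  discovers nothing, and such a pass has found no conflict. Only \<open>(k l)\<^sup>l\<close> schedules are tried, each
  decoded from a number by repeated subtraction.
\<close>

section \<open>Structured programs\<close>

text \<open>Naming vertices in a schedule would multiply the number of guesses by a power of
  \<open>n\<close>; indices avoid this at the price of a circularity, as the meaning of an index
  depends on the list and the list on the schedule. Soundness is immune to it: the executed moves of
  a pass without conflict are themselves a legal sequence, however its list came about. Completeness
  rests on two facts. The list grows only at its end, so an index keeps its meaning. And along the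
  schedule of a genuine solution, a pass that leaves the list fixed gives all listed vertices their
  true colours, so that a conflict could involve only an unlisted vertex, which would then be
  discovered.

  Decoding a guess by subtraction takes time linear in the guess, so the running time is quadratic
  in \<open>(k * l) ^ l\<close>. This fits the claimed bound because
  \<open>2 * l + 1 \<le> l * l + l\<close> for \<open>l \<ge> 2\<close>; the case
  \<open>l = 1\<close> is an exact fit. Each schedule entry scans one column of the matrix, so the
  dependence on \<open>n\<close> is linear.\<close>

type_synonym store = "(nat \<Rightarrow> nat) \<times> (nat \<Rightarrow> nat)"

datatype com =
    Block "instr list"
  | Seq com com (infixr \<open>;;\<close> 60)
  | If_Nonzero nat com
  | While_Nonzero nat com

fun code_length :: "com \<Rightarrow> nat" where
  "code_length (Block is) = length is"
| "code_length (c ;; d) = code_length c + code_length d"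
| "code_length (If_Nonzero r c) = Suc (code_length c)"
| "code_length (While_Nonzero r c) = Suc (Suc (code_length c))"

text \<open>Register 1 is kept at 0, which makes \<^term>\<open>Jump_Zero 1 b\<close> an unconditional jump.\<close>

fun compile :: "nat \<Rightarrow> com \<Rightarrow> ram_program" where
  "compile b (Block is) = is"
| "compile b (c ;; d) = compile b c @ compile (b + code_length c) d"
| "compile b (If_Nonzero r c) = Jump_Zero r (Suc (b + code_length c)) # compile (Suc b) c"
| "compile b (While_Nonzero r c) =
     Jump_Zero r (Suc (Suc (b + code_length c))) # compile (Suc b) c @ [Jump_Zero 1 b]"

fun safe_instr :: "instr \<Rightarrow> bool" where
  "safe_instr (Const i c) \<longleftrightarrow> i \<noteq> 1"
| "safe_instr (Add i j k) \<longleftrightarrow> i \<noteq> 1"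
| "safe_instr (Sub i j k) \<longleftrightarrow> i \<noteq> 1"
| "safe_instr (Load i j) \<longleftrightarrow> i \<noteq> 1"
| "safe_instr (Store i j) \<longleftrightarrow> True"
| "safe_instr (Jump_Zero i l) \<longleftrightarrow> False"

fun safe :: "com \<Rightarrow> bool" where
  "safe (Block is) \<longleftrightarrow> list_all safe_instr is"
| "safe (c ;; d) \<longleftrightarrow> safe c \<and> safe d"
| "safe (If_Nonzero r c) \<longleftrightarrow> safe c"
| "safe (While_Nonzero r c) \<longleftrightarrow> safe c"

fun effect :: "instr \<Rightarrow> store \<Rightarrow> store" where
  "effect (Const i c) (R, M) = (R(i := c), M)"
| "effect (Add i j k) (R, M) = (R(i := R j + R k), M)"
| "effect (Sub i j k) (R, M) = (R(i := R j - R k), M)"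
| "effect (Load i j) (R, M) = (R(i := M (R j)), M)"
| "effect (Store i j) (R, M) = (R, M(R i := R j))"
| "effect (Jump_Zero i l) (R, M) = (R, M)"

text \<open>The number counts the instructions of the compiled code: one per conditional jump, and
  in each loop iteration one more for the jump back to the test.\<close>

inductive big_step :: "com \<Rightarrow> store \<Rightarrow> nat \<Rightarrow> store \<Rightarrow> bool" where
  Block: "big_step (Block is) s (length is) (fold effect is s)"
| Seq: "big_step c s t s' \<Longrightarrow> big_step d s' t' s'' \<Longrightarrow> big_step (c ;; d) s (t + t') s''"
| If_0: "fst s r = 0 \<Longrightarrow> big_step (If_Nonzero r c) s 1 s"
| If_1: "fst s r \<noteq> 0 \<Longrightarrow> big_step c s t s' \<Longrightarrow> big_step (If_Nonzero r c) s (Suc t) s'"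
| While_0: "fst s r = 0 \<Longrightarrow> big_step (While_Nonzero r c) s 1 s"
| While_1: "fst s r \<noteq> 0 \<Longrightarrow> big_step c s t s' \<Longrightarrow> big_step (While_Nonzero r c) s' t' s'' \<Longrightarrow>
    big_step (While_Nonzero r c) s (Suc (t + Suc t')) s''"

lemma length_compile [simp]: "length (compile b c) = code_length c"
  by (induction c arbitrary: b) auto

lemma exec_safe_instr:
  assumes "safe_instr i" "fst s 1 = 0"
  shows "exec_instr i (pc, s) = (Suc pc, effect i s) \<and> fst (effect i s) 1 = 0"
  using assms by (cases i; cases s) auto

lemma ram_step_at:
  assumes "P = pre @ i # post"
  shows "ram_step P (length pre, s) = exec_instr i (length pre, s)"
  using assms by (simp add: ram_step_def halted_def nth_append)

lemma ram_steps_Suc: "(ram_step P ^^ Suc t) s = (ram_step P ^^ t) (ram_step P s)"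
  by (simp only: funpow_Suc_right comp_def)

lemma ram_steps_add: "(ram_step P ^^ (t + t')) s = (ram_step P ^^ t') ((ram_step P ^^ t) s)"
  by (metis add.commute comp_def funpow_add)

lemma ram_steps_block:
  assumes "P = pre @ is @ post" "list_all safe_instr is" "fst s 1 = 0"
  shows "(ram_step P ^^ length is) (length pre, s) = (length pre + length is, fold effect is s) \<and>
    fst (fold effect is s) 1 = 0"
  using assms
proof (induction "is" arbitrary: pre s)
  case (Cons i "is")
  have "exec_instr i (length pre, s) = (Suc (length pre), effect i s)" "fst (effect i s) 1 = 0"
    using exec_safe_instr Cons.prems by auto
  moreover have "ram_step P (length pre, s) = exec_instr i (length pre, s)"
    using ram_step_at[of P pre i "is @ post" s] Cons.prems(1) by simp
  ultimately show ?case
    using Cons.IH[of "pre @ [i]" "effect i s"] Cons.prems by (simp add: ram_steps_Suc del: funpow.simps)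
qed auto

text \<open>Jump targets are absolute, so the code sits at an arbitrary offset
  \<open>length pre\<close>, and the induction generalises over the surrounding \<open>pre\<close>
  and \<open>post\<close>. The zero in register 1 is carried along for the jumps that close
  loops.\<close>

lemma compile_correct:
  assumes "big_step c s t s'" "safe c" "fst s 1 = 0" "P = pre @ compile (length pre) c @ post"
  shows "(ram_step P ^^ t) (length pre, s) = (length pre + code_length c, s') \<and> fst s' 1 = 0"
  using assms
proof (induction arbitrary: pre post rule: big_step.induct)
  case (Block "is" s)
  then show ?case using ram_steps_block[of P pre "is" post s] by simp
next
  case (Seq c s t s' d t' s'')
  have "(ram_step P ^^ t) (length pre, s) = (length pre + code_length c, s') \<and> fst s' 1 = 0"
    using Seq.prems by (intro Seq.IH(1)[of pre "compile (length pre + code_length c) d @ post"]) auto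
  moreover have "fst s' 1 = 0 \<Longrightarrow>
      (ram_step P ^^ t') (length (pre @ compile (length pre) c), s') =
        (length (pre @ compile (length pre) c) + code_length d, s'') \<and> fst s'' 1 = 0"
    using Seq.prems by (intro Seq.IH(2)[of "pre @ compile (length pre) c" post]) auto
  ultimately show ?case by (simp add: ram_steps_add)
next
  case (If_0 s r c)
  then have "ram_step P (length pre, s) = (length pre + Suc (code_length c), s)"
    using ram_step_at[of P pre "Jump_Zero r (Suc (length pre + code_length c))"
        "compile (Suc (length pre)) c @ post" s]
    by (cases s) simp
  then show ?case using If_0 by simp
next
  case (If_1 s r c t s')
  let ?j = "Jump_Zero r (Suc (length pre + code_length c))"
  have "ram_step P (length pre, s) = (Suc (length pre), s)"
    using ram_step_at[of P pre ?j "compile (Suc (length pre)) c @ post" s] If_1 by (cases s) simp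
  moreover have "(ram_step P ^^ t) (length (pre @ [?j]), s) =
      (length (pre @ [?j]) + code_length c, s') \<and> fst s' 1 = 0"
    using If_1.prems by (intro If_1.IH[of "pre @ [?j]" post]) auto
  ultimately show ?case by (simp add: ram_steps_Suc del: funpow.simps)
next
  case (While_0 s r c)
  then have "ram_step P (length pre, s) = (length pre + Suc (Suc (code_length c)), s)"
    using ram_step_at[of P pre "Jump_Zero r (Suc (Suc (length pre + code_length c)))"
        "compile (Suc (length pre)) c @ Jump_Zero 1 (length pre) # post" s]
    by (cases s) simp
  then show ?case using While_0 by simp
next
  case (While_1 s r c t s' t' s'')
  let ?j = "Jump_Zero r (Suc (Suc (length pre + code_length c)))"
  let ?pre = "pre @ ?j # compile (Suc (length pre)) c"
  have 1: "ram_step P (length pre, s) = (Suc (length pre), s)"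
    using ram_step_at[of P pre ?j "compile (Suc (length pre)) c @ Jump_Zero 1 (length pre) # post" s]
      While_1 by (cases s) simp
  have 2: "(ram_step P ^^ t) (length (pre @ [?j]), s) =
      (length (pre @ [?j]) + code_length c, s') \<and> fst s' 1 = 0"
    using While_1.prems
    by (intro While_1.IH(1)[of "pre @ [?j]" "Jump_Zero 1 (length pre) # post"]) auto
  then have 3: "ram_step P (length ?pre, s') = (length pre, s')"
    using ram_step_at[of P ?pre "Jump_Zero 1 (length pre)" post s'] While_1.prems by (cases s') simp
  \<comment> \<open>The jump back has reset the counter to \<open>length pre\<close>, so the
    hypothesis for the remaining iterations applies with the same surrounding code.\<close>
  have "(ram_step P ^^ t') (length pre, s') =
      (length pre + code_length (While_Nonzero r c), s'') \<and> fst s'' 1 = 0"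
    using 2 While_1.prems by (intro While_1.IH(2)[of pre post]) auto
  moreover have "(ram_step P ^^ Suc (t + Suc t')) x =
      (ram_step P ^^ t') (ram_step P ((ram_step P ^^ t) (ram_step P x)))" for x
    by (simp only: ram_steps_Suc ram_steps_add)
  ultimately show ?case
    using 1 2 3 by simp
qed

section \<open>Time-bounded total correctness\<close>

definition runs :: "com \<Rightarrow> store \<Rightarrow> nat \<Rightarrow> (store \<Rightarrow> bool) \<Rightarrow> bool" where
  "runs c s T Q \<longleftrightarrow> (\<exists>t\<le>T. \<exists>s'. big_step c s t s' \<and> Q s')"

lemma outputs_withinI:
  assumes "runs c (\<lambda>_. 0, \<lambda>i. if i < length xs then xs ! i else 0) T (\<lambda>s. fst s 0 = y)" "safe c"
  shows "outputs_within (compile 0 c) xs y T"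
proof -
  obtain t s' where t: "t \<le> T" "fst s' 0 = y"
    "big_step c (\<lambda>_. 0, \<lambda>i. if i < length xs then xs ! i else 0) t s'"
    using assms(1) unfolding runs_def by blast
  have "(ram_step (compile 0 c) ^^ t) (initial_config xs) = (code_length c, s')"
    using compile_correct[OF t(3) assms(2), of "compile 0 c" "[]" "[]"] by (simp add: initial_config_def)
  then have "outputs_within (compile 0 c) xs y t"
    using t(2) by (simp add: outputs_within_def halted_def)
  then show ?thesis using t(1) outputs_within_mono by blast
qed

lemma runs_weaken: "runs c s T Q \<Longrightarrow> T \<le> T' \<Longrightarrow> (\<And>s'. Q s' \<Longrightarrow> Q' s') \<Longrightarrow> runs c s T' Q'"
  unfolding runs_def using le_trans by blast

text \<open>The postcondition of the first command is itself a \<open>runs\<close> statement about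
  the second, so no intermediate state has to be named.\<close>

lemma runs_Seq:
  assumes "runs c s T (\<lambda>s'. runs d s' T' Q)" "T + T' \<le> T''"
  shows "runs (c ;; d) s T'' Q"
proof -
  obtain t s' t' s'' where *: "t \<le> T" "big_step c s t s'" "t' \<le> T'" "big_step d s' t' s''" "Q s''"
    using assms(1) unfolding runs_def by blast
  then have "t + t' \<le> T''" using assms(2) by simp
  then show ?thesis
    unfolding runs_def using big_step.Seq[OF *(2,4)] *(5) by blast
qed

lemma runs_weaken_store:
  assumes "runs c s T (\<lambda>(R, M). P R M)" "\<And>R M. P R M \<Longrightarrow> Q (R, M)" "T \<le> T'"
  shows "runs c s T' Q"
  by (rule runs_weaken[OF assms(1,3)]) (use assms(2) in auto)

lemma runs_Seq_store:
  assumes "runs c s T (\<lambda>(R, M). P R M)" "\<And>R M. P R M \<Longrightarrow> runs d (R, M) T' Q" "T + T' \<le> T''"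
  shows "runs (c ;; d) s T'' Q"
proof (rule runs_Seq[OF _ assms(3)])
  show "runs c s T (\<lambda>s'. runs d s' T' Q)"
    by (rule runs_weaken_store[OF assms(1) _ le_refl]) (rule assms(2))
qed

lemma runs_If:
  assumes "fst s r \<noteq> 0 \<Longrightarrow> runs c s T Q" "fst s r = 0 \<Longrightarrow> Q s"
  shows "runs (If_Nonzero r c) s (Suc T) Q"
proof (cases "fst s r = 0")
  case True
  moreover have "1 \<le> Suc T" by simp
  ultimately show ?thesis using assms(2) big_step.If_0[of s r c] unfolding runs_def by blast
next
  case False
  then show ?thesis
    using assms(1) big_step.If_1[OF False, of c] unfolding runs_def by (meson Suc_le_mono)
qed

fun loop_free :: "com \<Rightarrow> bool" where
  "loop_free (Block is) \<longleftrightarrow> True"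
| "loop_free (c ;; d) \<longleftrightarrow> loop_free c \<and> loop_free d"
| "loop_free (If_Nonzero r c) \<longleftrightarrow> loop_free c"
| "loop_free (While_Nonzero r c) \<longleftrightarrow> False"

fun apply_com :: "com \<Rightarrow> store \<Rightarrow> store" where
  "apply_com (Block is) s = fold effect is s"
| "apply_com (c ;; d) s = apply_com d (apply_com c s)"
| "apply_com (If_Nonzero r c) s = (if fst s r = 0 then s else apply_com c s)"
| "apply_com (While_Nonzero r c) s = s"

text \<open>Without loops no instruction is executed twice, so the code length bounds the time, and
  correctness becomes simplification of \<open>apply_com\<close>.\<close>

lemma runs_loop_free:
  assumes "loop_free c" "Q (apply_com c s)" "code_length c \<le> T"
  shows "runs c s T Q"
proof -
  have "\<exists>t\<le>code_length c. big_step c s t (apply_com c s)" if "loop_free c" for c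
    using that
  proof (induction c arbitrary: s)
    case (Block "is")
    then show ?case by (intro exI[of _ "length is"]) (simp add: big_step.Block)
  next
    case (Seq c d)
    obtain t t' where "t \<le> code_length c" "big_step c s t (apply_com c s)"
      "t' \<le> code_length d" "big_step d (apply_com c s) t' (apply_com d (apply_com c s))"
      using Seq.IH(1)[of s] Seq.IH(2)[of "apply_com c s"] Seq.prems by auto
    then show ?case using big_step.Seq by (intro exI[of _ "t + t'"]) auto
  next
    case (If_Nonzero r c)
    then obtain t where "t \<le> code_length c" "big_step c s t (apply_com c s)"
      using loop_free.simps(3) by blast
    then show ?case
      using big_step.If_0[of s r c] big_step.If_1[of s r c t "apply_com c s"]
      by (cases "fst s r = 0") (auto intro: exI[of _ "Suc t"] exI[of _ "Suc 0"])
  qed auto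
  then show ?thesis using assms le_trans unfolding runs_def by blast
qed

text \<open>The index of \<open>J\<close> is a variant, so there are at most \<open>m\<close>
  iterations; each pays for the body, the test and the jump back, and the last test adds 1.\<close>

lemma runs_While:
  assumes "J m s"
    "\<And>m s. J m s \<Longrightarrow> fst s r \<noteq> 0 \<Longrightarrow> runs c s T (\<lambda>s'. \<exists>m'<m. J m' s')"
    "\<And>m s. J m s \<Longrightarrow> fst s r = 0 \<Longrightarrow> Q s"
  shows "runs (While_Nonzero r c) s (m * (T + 2) + 1) Q"
  using assms(1)
proof (induction m arbitrary: s rule: less_induct)
  case (less m)
  show ?case
  proof (cases "fst s r = 0")
    case True
    then show ?thesis
      using assms(3)[OF less.prems] big_step.While_0[of s r c] le_add2[of 1] unfolding runs_def
      by blast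
  next
    case False
    then obtain t s' m' where 1: "t \<le> T" "big_step c s t s'" "m' < m" "J m' s'"
      using assms(2)[OF less.prems] unfolding runs_def by blast
    then obtain t' s'' where 2: "t' \<le> m' * (T + 2) + 1" "big_step (While_Nonzero r c) s' t' s''" "Q s''"
      using less.IH[of m' s'] unfolding runs_def by blast
    have "Suc m' * (T + 2) \<le> m * (T + 2)"
      using 1(3) by (intro mult_right_mono) auto
    then have "Suc (t + Suc t') \<le> m * (T + 2) + 1" using 1(1) 2(1) by simp
    then show ?thesis
      using big_step.While_1[OF False 1(2) 2(2)] 2(3) unfolding runs_def by blast
  qed
qed

text \<open>Register \<open>b\<close> holds the number of remaining iterations and, briefly, the
  constant 1 for the increment. It is recomputed from \<open>r\<close> and \<open>i\<close>, so the
  body may overwrite it.\<close>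

definition For :: "nat \<Rightarrow> nat \<Rightarrow> nat \<Rightarrow> com \<Rightarrow> com" where
  "For i r b c = Block [Const i 0, Sub b r i] ;;
     While_Nonzero b (c ;; Block [Const b 1, Add i i b, Sub b r i])"

lemma safe_For [simp]: "safe (For i r b c) \<longleftrightarrow> i \<noteq> 1 \<and> b \<noteq> 1 \<and> safe c"
  by (auto simp: For_def)

text \<open>\<open>J\<close> refers to the registers after the increment that follows the body. The
  overhead 5 is the test, the jump back and three instructions of the increment; the final 3 are the
  initialisation and the last test.\<close>

lemma runs_For:
  assumes distinct: "distinct [i, r, b]"
    and init: "J 0 (R(i := 0, b := R r)) M"
    and step: "\<And>j R' M'. j < R r \<Longrightarrow> J j R' M' \<Longrightarrow> R' i = j \<Longrightarrow> R' r = R r \<Longrightarrow>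
      runs c (R', M') T (\<lambda>(R'', M''). R'' i = j \<and> R'' r = R r \<and>
        J (Suc j) (R''(i := Suc j, b := R r - Suc j)) M'')"
    and final: "\<And>R' M'. J (R r) R' M' \<Longrightarrow> R' r = R r \<Longrightarrow> Q (R', M')"
    and time: "R r * (T + 5) + 3 \<le> T'"
  shows "runs (For i r b c) (R, M) T' Q"
proof -
  define I where "I m s \<longleftrightarrow> m = fst s b \<and> fst s r = R r \<and> (\<exists>j\<le>R r. fst s i = j \<and> m = R r - j \<and>
     J j (fst s) (snd s))" for m and s :: store
  have "runs (While_Nonzero b (c ;; Block [Const b 1, Add i i b, Sub b r i]))
      (R(i := 0, b := R r), M) (R r * ((T + 3) + 2) + 1) Q"
  proof (rule runs_While[where J = I])
    show "I (R r) (R(i := 0, b := R r), M)"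
      using distinct init by (auto simp: I_def)
  next
    fix m s assume "I m s" "fst s b \<noteq> 0"
    then obtain j where j: "j < R r" "J j (fst s) (snd s)" "fst s i = j" "fst s r = R r" "m = R r - j"
      by (auto simp: I_def)
    have "runs c s T (\<lambda>(R'', M''). R'' i = j \<and> R'' r = R r \<and>
        J (Suc j) (R''(i := Suc j, b := R r - Suc j)) M'')"
      using step[OF j(1-4)] by simp
    then have "runs c s T (\<lambda>s'. runs (Block [Const b 1, Add i i b, Sub b r i]) s' 3 (\<lambda>s'. \<exists>m'<m. I m' s'))"
    proof (rule runs_weaken[OF _ le_refl])
      fix s' :: store
      obtain R'' M'' where s': "s' = (R'', M'')" by force
      assume "case s' of (R'', M'') \<Rightarrow> R'' i = j \<and> R'' r = R r \<and>
        J (Suc j) (R''(i := Suc j, b := R r - Suc j)) M''"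
      then have *: "R'' r = R r" "J (Suc j) (R''(i := Suc j, b := R r - Suc j)) M''" "R'' i = j"
        by (simp_all add: s')
      have "apply_com (Block [Const b 1, Add i i b, Sub b r i]) s' = (R''(i := Suc j, b := R r - Suc j), M'')"
        using distinct * by (auto simp: s')
      then show "runs (Block [Const b 1, Add i i b, Sub b r i]) s' 3 (\<lambda>s'. \<exists>m'<m. I m' s')"
        using distinct j(1,5) *
        by (intro runs_loop_free) (auto simp: I_def intro!: exI[of _ "R r - Suc j"] simp del: apply_com.simps)
    qed
    then show "runs (c ;; Block [Const b 1, Add i i b, Sub b r i]) s (T + 3) (\<lambda>s'. \<exists>m'<m. I m' s')"
      by (rule runs_Seq) simp
  next
    fix m s assume "I m s" "fst s b = 0"
    then show "Q s"
      using final[of "fst s" "snd s"] by (auto simp: I_def)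
  qed
  then have "runs (Block [Const i 0, Sub b r i]) (R, M) 2
      (\<lambda>s. runs (While_Nonzero b (c ;; Block [Const b 1, Add i i b, Sub b r i])) s
         (R r * ((T + 3) + 2) + 1) Q)"
    by (intro runs_loop_free[of "Block _"]) (use distinct in auto)
  then show ?thesis
    unfolding For_def using time by (elim runs_Seq) (simp add: algebra_simps)
qed

section \<open>Schedules and their simulation\<close>

fun recolour :: "('a \<Rightarrow> 'c) \<Rightarrow> ('a \<times> 'c) list \<Rightarrow> 'a \<Rightarrow> 'c" where
  "recolour g [] = g"
| "recolour g ((y, c) # ys) = recolour (g(y := c)) ys"

lemma recolour_append: "recolour g (xs @ ys) = recolour (recolour g xs) ys"
  by (induction xs arbitrary: g) auto

lemma recolour_unscheduled: "w \<notin> fst ` set ys \<Longrightarrow> recolour g ys w = g w"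
  by (induction ys arbitrary: g) auto

definition by_index :: "nat list \<Rightarrow> nat \<Rightarrow> nat option" where
  "by_index vs i = (if i < length vs then Some (vs ! i) else None)"

definition by_vertex :: "nat list \<Rightarrow> nat \<Rightarrow> nat option" where
  "by_vertex vs y = (if y \<in> set vs then Some y else None)"

lemma by_index_simps [simp]:
  "i < length vs \<Longrightarrow> by_index vs i = Some (vs ! i)"
  "\<not> i < length vs \<Longrightarrow> by_index vs i = None"
  by (simp_all add: by_index_def)

lemma by_vertex_simps [simp]:
  "y \<in> set vs \<Longrightarrow> by_vertex vs y = Some y"
  "y \<notin> set vs \<Longrightarrow> by_vertex vs y = None"
  by (simp_all add: by_vertex_def)

text \<open>An absent vertex gets the first index beyond the list, which \<open>by_index\<close>
  treats as undiscovered on the list and on all its prefixes.\<close>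

definition position :: "nat list \<Rightarrow> nat \<Rightarrow> nat" where
  "position vs y = (if y \<in> set vs then (LEAST i. i < length vs \<and> vs ! i = y) else length vs)"

text \<open>Positions in the final list serve every earlier list as well: by distinctness, a
  position falls into the prefix iff the vertex does.\<close>

lemma by_index_position:
  assumes "distinct (vs @ ws)"
  shows "by_index vs (position (vs @ ws) y) = by_vertex vs y"
proof (cases "y \<in> set (vs @ ws)")
  case True
  let ?i = "position (vs @ ws) y"
  have "?i < length (vs @ ws) \<and> (vs @ ws) ! ?i = y"
    unfolding position_def using True
    by (smt (verit, ccfv_threshold) LeastI in_set_conv_nth)
  moreover have "?i < length vs \<longleftrightarrow> y \<in> set vs"
  proof
    assume "y \<in> set vs"
    then obtain j where "j < length vs" "vs ! j = y" by (auto simp: in_set_conv_nth)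
    then show "?i < length vs"
      using calculation assms nth_eq_iff_index_eq[of "vs @ ws" j ?i] by (auto simp: nth_append)
  qed (use calculation in \<open>metis nth_append nth_mem\<close>)
  ultimately show ?thesis
    by (auto simp: by_index_def by_vertex_def nth_append)
next
  case False
  then show ?thesis by (auto simp: by_index_def by_vertex_def position_def)
qed

locale recolouring =
  fixes n k l :: nat and adj :: "nat \<Rightarrow> nat \<Rightarrow> bool" and \<alpha> \<beta> :: "nat \<Rightarrow> nat"
begin

text \<open>A move that keeps the colour of its vertex is not ruled out; such moves later pad a
  solution to exactly \<open>l\<close> entries.\<close>

fun legal :: "(nat \<Rightarrow> nat) \<Rightarrow> (nat \<times> nat) list \<Rightarrow> bool" where
  "legal g [] \<longleftrightarrow> True"
| "legal g ((y, c) # ys) \<longleftrightarrow>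
     y < n \<and> 1 \<le> c \<and> c \<le> k \<and> (\<forall>w<n. adj y w \<longrightarrow> g w \<noteq> c) \<and> legal (g(y := c)) ys"

lemma legal_append: "legal g (xs @ ys) \<longleftrightarrow> legal g xs \<and> legal (recolour g xs) ys"
  by (induction xs arbitrary: g) auto

definition reachable :: bool where
  "reachable \<longleftrightarrow> (\<exists>ys. length ys \<le> l \<and> legal \<alpha> ys \<and> (\<forall>w<n. recolour \<alpha> ys w = \<beta> w))"

text \<open>The flag drops even if \<open>w\<close> is already listed: a clash with a known vertex
  is a conflict although it discovers nothing.\<close>

fun mark :: "nat \<Rightarrow> nat list \<times> bool \<Rightarrow> nat list \<times> bool" where
  "mark w (vs, ok) = (if w \<in> set vs then vs else vs @ [w], False)"

definition mark_if :: "(nat \<Rightarrow> bool) \<Rightarrow> nat \<Rightarrow> nat list \<times> bool \<Rightarrow> nat list \<times> bool" where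
  "mark_if p j = fold mark (filter p [0..<j])"

lemma mark_if_0 [simp]: "mark_if p 0 s = s"
  by (simp add: mark_if_def)

lemma mark_if_Suc: "mark_if p (Suc j) s = (if p j then mark j (mark_if p j s) else mark_if p j s)"
  by (simp add: mark_if_def)

text \<open>
  The simulation is parametric in how a schedule entry selects a vertex from the discovered ones:
  the machine selects by index, whereas the completeness proof first runs a schedule that names its
  vertices and afterwards replaces each vertex by its position in the final list of that run.
\<close>

type_synonym simulation_state = "(nat \<Rightarrow> nat) \<times> nat list \<times> bool"

fun sim_step :: "(nat list \<Rightarrow> nat \<Rightarrow> nat option) \<Rightarrow> nat \<times> nat \<Rightarrow> simulation_state \<Rightarrow> simulation_state"
  where
  "sim_step sel (i, c) (g, vs, ok) =
     (case sel vs i of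
        None \<Rightarrow> (g, vs, ok)
      | Some u \<Rightarrow> (g(u := c), mark_if (\<lambda>w. adj u w \<and> g w = c) n (vs, ok)))"

definition sim_end :: "simulation_state \<Rightarrow> nat list \<times> bool" where
  "sim_end s = mark_if (\<lambda>w. fst s w \<noteq> \<beta> w) n (snd s)"

text \<open>Only the list survives from one pass to the next. Moves are carried out in spite of
  conflicts, so one pass may discover several vertices.\<close>

definition sim_pass ::
    "(nat list \<Rightarrow> nat \<Rightarrow> nat option) \<Rightarrow> (nat \<times> nat) list \<Rightarrow> nat list \<Rightarrow> nat list \<times> bool" where
  "sim_pass sel D vs = sim_end (fold (sim_step sel) D (\<alpha>, vs, True))"

definition passes ::
    "(nat list \<Rightarrow> nat \<Rightarrow> nat option) \<Rightarrow> (nat \<times> nat) list \<Rightarrow> nat \<Rightarrow> nat list \<times> bool" where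
  "passes sel D j = ((\<lambda>(vs, ok). sim_pass sel D vs) ^^ j) ([], False)"

lemma passes_0 [simp]: "passes sel D 0 = ([], False)"
  by (simp add: passes_def)

lemma passes_Suc: "passes sel D (Suc j) = sim_pass sel D (fst (passes sel D j))"
  by (simp add: passes_def case_prod_beta)

definition accepts :: "(nat \<times> nat) list \<Rightarrow> bool" where
  "accepts D \<longleftrightarrow> snd (passes by_index D (Suc l))"

section \<open>Growth of the list and soundness\<close>

lemma mark_if_cases:
  "(mark_if p j (vs, ok) = (vs, ok) \<and> (\<forall>w<j. \<not> p w)) \<or>
   (\<not> snd (mark_if p j (vs, ok)) \<and> (\<exists>w<j. p w))"
proof (induction j)
  case (Suc j)
  show ?case
    using Suc by (cases "mark_if p j (vs, ok)") (auto simp: mark_if_Suc less_Suc_eq)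
qed auto

lemma mark_if_True:
  assumes "mark_if p j (vs, ok) = (vs', True)"
  shows "vs' = vs \<and> ok \<and> (\<forall>w<j. \<not> p w)"
  using mark_if_cases[of p j vs ok] assms by auto

lemma mark_if_extends:
  "\<exists>ws. fst (mark_if p j (vs, ok)) = vs @ ws \<and> set ws \<subseteq> {w. w < j \<and> p w} \<and>
     (distinct vs \<longrightarrow> distinct (vs @ ws)) \<and> {w. w < j \<and> p w} \<subseteq> set (vs @ ws)"
proof (induction j)
  case (Suc j)
  then obtain ws where ws: "fst (mark_if p j (vs, ok)) = vs @ ws" "set ws \<subseteq> {w. w < j \<and> p w}"
    "distinct vs \<longrightarrow> distinct (vs @ ws)" "{w. w < j \<and> p w} \<subseteq> set (vs @ ws)"
    by blast
  obtain ok' where eq: "mark_if p j (vs, ok) = (vs @ ws, ok')"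
    using ws(1) by (metis prod.collapse)
  show ?case
  proof (cases "p j \<and> j \<notin> set (vs @ ws)")
    case True
    then show ?thesis
      using ws eq by (intro exI[of _ "ws @ [j]"]) (auto simp: mark_if_Suc less_Suc_eq)
  next
    case False
    then show ?thesis
      using ws eq by (intro exI[of _ ws]) (auto simp: mark_if_Suc less_Suc_eq)
  qed
qed auto

text \<open>A flag still raised was never lowered, so no vertex joined the list and every executed
  move passed its neighbour test. Entries with an index beyond the list are skipped, so
  \<open>ys\<close> may be shorter than \<open>D\<close>.\<close>

lemma fold_step_True:
  assumes "fold (sim_step by_index) D (g, vs, ok) = (g', vs', True)" "set vs \<subseteq> {..<n}"
    "\<forall>(i, c) \<in> set D. 1 \<le> c \<and> c \<le> k"
  shows "vs' = vs \<and> ok \<and> (\<exists>ys. length ys \<le> length D \<and> legal g ys \<and> recolour g ys = g')"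
  using assms
proof (induction D arbitrary: g vs ok)
  case Nil
  then show ?case by (auto intro: exI[of _ "[]"])
next
  case (Cons d D)
  obtain i c where d: "d = (i, c)" by force
  show ?case
  proof (cases "i < length vs")
    case False
    then have "vs' = vs \<and> ok \<and> (\<exists>ys. length ys \<le> length D \<and> legal g ys \<and> recolour g ys = g')"
      using Cons.IH[of g vs ok] Cons.prems by (simp add: d)
    then show ?thesis by (auto intro: le_SucI)
  next
    case True
    let ?p = "\<lambda>w. adj (vs ! i) w \<and> g w = c"
    obtain vs1 ok1 where m: "mark_if ?p n (vs, ok) = (vs1, ok1)" by force
    have "set vs1 \<subseteq> {..<n}"
      using mark_if_extends[of ?p n vs ok] m Cons.prems(2) by auto
    moreover have "fold (sim_step by_index) D (g(vs ! i := c), vs1, ok1) = (g', vs', True)"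
      using Cons.prems(1) True m by (simp add: d)
    ultimately have IH: "vs' = vs1 \<and> ok1 \<and>
        (\<exists>ys. length ys \<le> length D \<and> legal (g(vs ! i := c)) ys \<and> recolour (g(vs ! i := c)) ys = g')"
      using Cons.prems(3) by (intro Cons.IH) (simp_all del: fun_upd_apply)
    then obtain ys where ys: "length ys \<le> length D" "legal (g(vs ! i := c)) ys"
      "recolour (g(vs ! i := c)) ys = g'" by blast
    have *: "vs1 = vs" "ok" "\<forall>w<n. \<not> ?p w"
      using mark_if_True[of ?p n vs ok vs1] m IH by auto
    have "vs ! i < n" using True Cons.prems(2) nth_mem by blast
    then have "legal g ((vs ! i, c) # ys) \<and> recolour g ((vs ! i, c) # ys) = g'"
      using ys * Cons.prems(3) by (simp add: d)
    then show ?thesis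
      using IH * ys(1) by (metis Suc_le_mono length_Cons)
  qed
qed

lemma fold_step_extends:
  "\<exists>ws. fst (snd (fold (sim_step sel) D (g, vs, ok))) = vs @ ws \<and> set ws \<subseteq> {..<n} \<and>
    (distinct vs \<longrightarrow> distinct (vs @ ws))"
proof (induction D arbitrary: g vs ok)
  case (Cons d D)
  obtain i c where d: "d = (i, c)" by force
  show ?case
  proof (cases "sel vs i")
    case (Some u)
    let ?p = "\<lambda>w. adj u w \<and> g w = c"
    obtain vs1 ok1 where m: "mark_if ?p n (vs, ok) = (vs1, ok1)" by force
    then obtain ws where ws: "vs1 = vs @ ws" "set ws \<subseteq> {..<n}" "distinct vs \<longrightarrow> distinct (vs @ ws)"
      using mark_if_extends[of ?p n vs ok] by auto
    obtain ws' where "fst (snd (fold (sim_step sel) D (g(u := c), vs1, ok1))) = vs1 @ ws'"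
      "set ws' \<subseteq> {..<n}" "distinct vs1 \<longrightarrow> distinct (vs1 @ ws')"
      using Cons by blast
    then show ?thesis
      using ws Some m by (intro exI[of _ "ws @ ws'"]) (simp add: d)
  next
    case None
    then show ?thesis using Cons[of g vs ok] by (simp add: d)
  qed
qed auto

lemma sim_pass_extends:
  "\<exists>ws. fst (sim_pass sel D vs) = vs @ ws \<and> set ws \<subseteq> {..<n} \<and> (distinct vs \<longrightarrow> distinct (vs @ ws))"
proof -
  obtain g' vs' ok' where f: "fold (sim_step sel) D (\<alpha>, vs, True) = (g', vs', ok')"
    by (metis prod_cases3)
  then obtain ws where "vs' = vs @ ws" "set ws \<subseteq> {..<n}" "distinct vs \<longrightarrow> distinct (vs @ ws)"
    using fold_step_extends[of sel D \<alpha> vs True] by auto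
  moreover obtain ws' where "fst (mark_if (\<lambda>w. g' w \<noteq> \<beta> w) n (vs', ok')) = vs' @ ws'"
    "set ws' \<subseteq> {..<n}" "distinct vs' \<longrightarrow> distinct (vs' @ ws')"
    using mark_if_extends[of "\<lambda>w. g' w \<noteq> \<beta> w" n vs' ok'] by auto
  ultimately show ?thesis
    by (intro exI[of _ "ws @ ws'"]) (auto simp: sim_pass_def sim_end_def f)
qed

lemma passes_vertices:
  "set (fst (passes sel D j)) \<subseteq> {..<n} \<and> distinct (fst (passes sel D j))"
proof (induction j)
  case (Suc j)
  then show ?case
    using sim_pass_extends[of sel D "fst (passes sel D j)"] by (auto simp: passes_Suc)
qed auto

lemma accepts_sound:
  assumes "accepts D" "length D \<le> l" "\<forall>(i, c) \<in> set D. 1 \<le> c \<and> c \<le> k"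
  shows reachable
proof -
  define vs where "vs = fst (passes by_index D l)"
  have vs: "set vs \<subseteq> {..<n}" using passes_vertices vs_def by blast
  obtain g' vs' ok' where f: "fold (sim_step by_index) D (\<alpha>, vs, True) = (g', vs', ok')"
    by (metis prod_cases3)
  obtain vs'' ok'' where e: "mark_if (\<lambda>w. g' w \<noteq> \<beta> w) n (vs', ok') = (vs'', ok'')" by force
  have "ok''"
    using assms(1) e by (simp add: accepts_def passes_Suc vs_def[symmetric] sim_pass_def sim_end_def f)
  then have *: "ok'" "\<forall>w<n. g' w = \<beta> w"
    using mark_if_True[of "\<lambda>w. g' w \<noteq> \<beta> w" n vs' ok' vs''] e by auto
  then obtain ys where "length ys \<le> length D" "legal \<alpha> ys" "recolour \<alpha> ys = g'"
    using fold_step_True[of D \<alpha> vs True g' vs'] f vs assms(3) by auto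
  then show ?thesis
    using * assms(2) unfolding reachable_def by (intro exI[of _ ys]) auto
qed

section \<open>Completeness for schedules that name their vertices\<close>

lemma legal_unscheduled:
  assumes "legal h ys" "fst ` set ys \<subseteq> Y" "\<forall>w. w \<notin> Y \<longrightarrow> h w = \<alpha> w" "(y, c) \<in> set ys"
    "w < n" "w \<notin> Y" "adj y w"
  shows "\<alpha> w \<noteq> c"
  using assms
proof (induction ys arbitrary: h)
  case (Cons a ys)
  obtain y' c' where a: "a = (y', c')" by force
  show ?case
  proof (cases "(y, c) = a")
    case True
    then show ?thesis using Cons.prems by auto
  next
    case False
    have "\<forall>w. w \<notin> Y \<longrightarrow> (h(y' := c')) w = \<alpha> w" using Cons.prems(2,3) a by auto
    moreover have "(y, c) \<in> set ys" "legal (h(y' := c')) ys" "fst ` set ys \<subseteq> Y"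
      using Cons.prems False a by auto
    ultimately show ?thesis using Cons.IH Cons.prems(5-7) by blast
  qed
qed auto

text \<open>The simulated colouring may differ from the true one, but outside \<open>Y\<close> both
  are still \<alpha>. A conflict there would thus be a conflict of the legal sequence with a vertex
  that never moves, so only vertices of \<open>Y\<close> are discovered.\<close>

lemma fold_step_scheduled:
  assumes "\<And>y c w. (y, c) \<in> set ys \<Longrightarrow> w < n \<Longrightarrow> w \<notin> Y \<Longrightarrow> adj y w \<Longrightarrow> \<alpha> w \<noteq> c"
    "set vs \<subseteq> Y" "\<forall>w. w \<notin> Y \<longrightarrow> g w = \<alpha> w"
    "fold (sim_step by_vertex) ys (g, vs, ok) = (g', vs', ok')"
  shows "set vs' \<subseteq> Y \<and> (\<forall>w. w \<notin> Y \<longrightarrow> g' w = \<alpha> w)"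
  using assms
proof (induction ys arbitrary: g vs ok)
  case (Cons a ys)
  obtain y c where a: "a = (y, c)" by force
  have sched: "\<And>y c w. (y, c) \<in> set ys \<Longrightarrow> w < n \<Longrightarrow> w \<notin> Y \<Longrightarrow> adj y w \<Longrightarrow> \<alpha> w \<noteq> c"
    by (rule Cons.prems(1)) simp_all
  show ?case
  proof (cases "y \<in> set vs")
    case True
    let ?p = "\<lambda>w. adj y w \<and> g w = c"
    obtain vs1 ok1 where m: "mark_if ?p n (vs, ok) = (vs1, ok1)" by force
    obtain ws where "vs1 = vs @ ws" "set ws \<subseteq> {w. w < n \<and> ?p w}"
      using mark_if_extends[of ?p n vs ok] m by auto
    moreover have "{w. w < n \<and> ?p w} \<subseteq> Y"
    proof clarify
      fix w assume "w < n" "adj y w" "c = g w"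
      then show "w \<in> Y" using Cons.prems(1)[of y c w] Cons.prems(3) a by (metis list.set_intros(1))
    qed
    ultimately have "set vs1 \<subseteq> Y"
      using Cons.prems(2) by simp
    moreover have "\<forall>w. w \<notin> Y \<longrightarrow> (g(y := c)) w = \<alpha> w"
      using Cons.prems(2,3) True by auto
    moreover have "fold (sim_step by_vertex) ys (g(y := c), vs1, ok1) = (g', vs', ok')"
      using Cons.prems(4) True m by (simp add: a)
    ultimately show ?thesis
      using Cons.IH[of vs1 "g(y := c)" ok1] sched by blast
  next
    case False
    then have "fold (sim_step by_vertex) ys (g, vs, ok) = (g', vs', ok')"
      using Cons.prems(4) by (simp add: a)
    then show ?thesis using Cons.IH[of vs g ok] sched Cons.prems(2,3) by blast
  qed
qed auto

lemma sim_pass_scheduled: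
  assumes "legal \<alpha> ys" "\<forall>w<n. recolour \<alpha> ys w = \<beta> w" "set vs \<subseteq> fst ` set ys"
  shows "set (fst (sim_pass by_vertex ys vs)) \<subseteq> fst ` set ys"
proof -
  obtain g' vs' ok' where f: "fold (sim_step by_vertex) ys (\<alpha>, vs, True) = (g', vs', ok')"
    by (metis prod_cases3)
  have *: "set vs' \<subseteq> fst ` set ys \<and> (\<forall>w. w \<notin> fst ` set ys \<longrightarrow> g' w = \<alpha> w)"
    using legal_unscheduled[OF assms(1), of "fst ` set ys"] assms(3) f
    by (intro fold_step_scheduled[of ys _ vs \<alpha> True g' vs' ok']) auto
  \<comment> \<open>An unscheduled vertex keeps its source colour both in the simulation and in the
    true sequence, and the latter ends in \<beta>.\<close>
  have "w \<in> fst ` set ys" if "w < n" "g' w \<noteq> \<beta> w" for w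
    using * that assms(2) recolour_unscheduled[of w ys \<alpha>] by metis
  then have "{w. w < n \<and> g' w \<noteq> \<beta> w} \<subseteq> fst ` set ys" by blast
  moreover obtain ws where "fst (mark_if (\<lambda>w. g' w \<noteq> \<beta> w) n (vs', ok')) = vs' @ ws"
    "set ws \<subseteq> {w. w < n \<and> g' w \<noteq> \<beta> w}"
    using mark_if_extends[of "\<lambda>w. g' w \<noteq> \<beta> w" n vs' ok'] by blast
  ultimately show ?thesis
    using * by (simp add: sim_pass_def sim_end_def f)
qed

lemma mark_if_unchanged:
  assumes "fst (mark_if p n (vs, ok)) = vs" "\<And>w. w \<in> set vs \<Longrightarrow> w < n \<Longrightarrow> \<not> p w"
  shows "mark_if p n (vs, ok) = (vs, ok)"
  using mark_if_cases[of p n vs ok] mark_if_extends[of p n vs ok] assms by auto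

text \<open>\<open>h\<close> is the true colouring, in which unlisted vertices move too; on the list
  it agrees with the simulated \<open>g\<close>. A conflict with a listed vertex would contradict
  legality, and one with an unlisted vertex would extend the list.\<close>

lemma fold_step_unchanged:
  assumes "fold (sim_step by_vertex) ys (g, vs, True) = (g', vs, ok')" "legal h ys"
    "\<forall>w \<in> set vs. g w = h w"
  shows "ok' \<and> (\<forall>w \<in> set vs. g' w = recolour h ys w)"
  using assms
proof (induction ys arbitrary: g h)
  case (Cons a ys)
  obtain y c where a: "a = (y, c)" by force
  show ?case
  proof (cases "y \<in> set vs")
    case True
    let ?p = "\<lambda>w. adj y w \<and> g w = c"
    obtain vs1 ok1 where m: "mark_if ?p n (vs, True) = (vs1, ok1)" by force
    have f: "fold (sim_step by_vertex) ys (g(y := c), vs1, ok1) = (g', vs, ok')"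
      using Cons.prems(1) True m by (simp add: a)
    \<comment> \<open>The list is \<open>vs\<close> at both ends of the fold and never
      shrinks.\<close>
    have "vs1 = vs"
      using mark_if_extends[of ?p n vs True] m fold_step_extends[of by_vertex ys "g(y := c)" vs1 ok1] f
      by auto
    then have "ok1"
      using mark_if_unchanged[of ?p vs True] m Cons.prems(2,3) by (simp add: a)
    have "\<forall>w \<in> set vs. (g(y := c)) w = (h(y := c)) w" "legal (h(y := c)) ys"
      using Cons.prems(2,3) by (simp_all add: a)
    then have "ok' \<and> (\<forall>w \<in> set vs. g' w = recolour (h(y := c)) ys w)"
      using Cons.IH[of "g(y := c)" "h(y := c)"] f \<open>vs1 = vs\<close> \<open>ok1\<close> by (simp del: fun_upd_apply)
    then show ?thesis by (simp add: a)
  next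
    case False
    then have "ok' \<and> (\<forall>w \<in> set vs. g' w = recolour (h(y := c)) ys w)"
      using Cons.prems Cons.IH[of g "h(y := c)"] by (auto simp: a fun_upd_def)
    then show ?thesis by (simp add: a)
  qed
qed auto

lemma sim_pass_unchanged:
  assumes "legal \<alpha> ys" "\<forall>w<n. recolour \<alpha> ys w = \<beta> w" "fst (sim_pass by_vertex ys vs) = vs"
  shows "snd (sim_pass by_vertex ys vs)"
proof -
  obtain g' vs' ok' where f: "fold (sim_step by_vertex) ys (\<alpha>, vs, True) = (g', vs', ok')"
    by (metis prod_cases3)
  have m: "fst (mark_if (\<lambda>w. g' w \<noteq> \<beta> w) n (vs', ok')) = vs"
    using assms(3) by (simp add: sim_pass_def sim_end_def f)
  have vs': "vs' = vs"
    using fold_step_extends[of by_vertex ys \<alpha> vs True] f m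
      mark_if_extends[of "\<lambda>w. g' w \<noteq> \<beta> w" n vs' ok'] by auto
  have "ok' \<and> (\<forall>w \<in> set vs. g' w = recolour \<alpha> ys w)"
    using fold_step_unchanged[of ys \<alpha> vs g' ok' \<alpha>] f assms(1) vs' by auto
  then show ?thesis
    using mark_if_unchanged[of "\<lambda>w. g' w \<noteq> \<beta> w" vs ok'] m assms(2)
    by (simp add: sim_pass_def sim_end_def f vs')
qed

lemma passes_scheduled:
  assumes "legal \<alpha> ys" "\<forall>w<n. recolour \<alpha> ys w = \<beta> w"
  shows "set (fst (passes by_vertex ys j)) \<subseteq> fst ` set ys"
proof (induction j)
  case (Suc j)
  then show ?case using sim_pass_scheduled[OF assms] by (simp add: passes_Suc)
qed auto

lemma passes_accept:
  assumes "legal \<alpha> ys" "\<forall>w<n. recolour \<alpha> ys w = \<beta> w" "length ys \<le> l"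
  shows "snd (passes by_vertex ys (Suc l))"
proof (rule ccontr)
  assume no: "\<not> ?thesis"
  let ?v = "\<lambda>j. fst (passes by_vertex ys j)"
  \<comment> \<open>A pass is determined by the list it starts from, so a pass that adds nothing is
    repeated by all later ones. If the last pass fails, every earlier pass must therefore have
    extended the list.\<close>
  have stuck: "?v (Suc i) = ?v i \<Longrightarrow> i \<le> j \<Longrightarrow> ?v (Suc j) = ?v j \<and> ?v j = ?v i" for i j
  proof (induction j)
    case (Suc j)
    then show ?case by (cases "i = Suc j") (auto simp: passes_Suc)
  qed auto
  have grow: "length (?v j) \<ge> j" if "j \<le> Suc l" for j
    using that
  proof (induction j)
    case (Suc j)
    have "?v (Suc j) \<noteq> ?v j"
    proof
      assume "?v (Suc j) = ?v j"
      then have "?v (Suc l) = ?v l" using stuck[of j l] Suc.prems by auto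
      then show False
        using sim_pass_unchanged[OF assms(1,2), of "?v l"] no by (simp add: passes_Suc)
    qed
    then have "length (?v (Suc j)) > length (?v j)"
      using sim_pass_extends[of by_vertex ys "?v j"] by (auto simp: passes_Suc)
    then show ?case using Suc by simp
  qed auto
  have "card (set (?v (Suc l))) \<le> card (fst ` set ys)"
    by (intro card_mono passes_scheduled[OF assms(1,2)]) simp
  also have "\<dots> \<le> length ys"
    by (metis card_image_le card_length le_trans List.finite_set)
  finally show False
    using grow[of "Suc l"] assms(3) passes_vertices[of by_vertex ys "Suc l"]
    by (simp add: distinct_card)
qed

section \<open>From vertex names to indices\<close>

abbreviation indexed :: "nat list \<Rightarrow> (nat \<times> nat) list \<Rightarrow> (nat \<times> nat) list" where
  "indexed vs \<equiv> map (\<lambda>(y, c). (position vs y, c))"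

text \<open>Every intermediate list is a prefix of \<open>V\<close>, so a position in
  \<open>V\<close> selects the same vertex as the name does, at each step of the run.\<close>

lemma fold_step_indexed:
  assumes "distinct V" "fst (snd (fold (sim_step by_vertex) ys (g, vs, ok))) @ ws = V"
  shows "fold (sim_step by_index) (indexed V ys) (g, vs, ok) = fold (sim_step by_vertex) ys (g, vs, ok)"
  using assms
proof (induction ys arbitrary: g vs ok)
  case (Cons a ys)
  obtain y c where a: "a = (y, c)" by force
  obtain ws' where "vs @ ws' = V"
    using fold_step_extends[of by_vertex "a # ys" g vs ok] Cons.prems(2) by auto
  then have "sim_step by_index (position V y, c) (g, vs, ok) = sim_step by_vertex (y, c) (g, vs, ok)"
    using by_index_position[of vs ws' y] Cons.prems(1) by simp
  then show ?case
    using Cons.IH[of "fst (sim_step by_vertex (y, c) (g, vs, ok))"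
      "fst (snd (sim_step by_vertex (y, c) (g, vs, ok)))" "snd (snd (sim_step by_vertex (y, c) (g, vs, ok)))"]
      Cons.prems by (simp add: a del: sim_step.simps)
qed auto

lemma sim_pass_indexed:
  assumes "distinct V" "fst (sim_pass by_vertex ys vs) @ ws = V"
  shows "sim_pass by_index (indexed V ys) vs = sim_pass by_vertex ys vs"
proof -
  obtain g' vs' ok' where f: "fold (sim_step by_vertex) ys (\<alpha>, vs, True) = (g', vs', ok')"
    by (metis prod_cases3)
  obtain ws' where "vs' @ ws' = V"
    using mark_if_extends[of "\<lambda>w. g' w \<noteq> \<beta> w" n vs' ok'] assms(2)
    by (auto simp: sim_pass_def sim_end_def f)
  then show ?thesis
    using fold_step_indexed[of V ys \<alpha> vs True ws'] assms(1) by (simp add: sim_pass_def f)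
qed

lemma passes_indexed:
  assumes "distinct V" "fst (passes by_vertex ys j) @ ws = V"
  shows "passes by_index (indexed V ys) j = passes by_vertex ys j"
  using assms(2)
proof (induction j arbitrary: ws)
  case (Suc j)
  obtain ws' where "fst (passes by_vertex ys j) @ ws' = V"
    using sim_pass_extends[of by_vertex ys "fst (passes by_vertex ys j)"] Suc.prems
    by (auto simp: passes_Suc)
  then show ?case
    using Suc sim_pass_indexed[OF assms(1)] by (simp add: passes_Suc)
qed auto

text \<open>The critical case is an undiscovered \<open>y\<close>, whose index is the length of the
  list. As \<open>y\<close> is scheduled but not listed, the list misses one of the scheduled
  vertices, so even this index is in range and \<open>l\<close> index values suffice.\<close>

lemma position_less:
  assumes "distinct vs" "set vs \<subseteq> fst ` set ys" "(y, c) \<in> set ys"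
  shows "position vs y < length ys"
proof -
  have le: "card (fst ` set ys) \<le> length ys"
    by (metis card_image_le card_length le_trans List.finite_set)
  show ?thesis
  proof (cases "y \<in> set vs")
    case True
    then have "position vs y < length vs"
      unfolding position_def using LeastI_ex[of "\<lambda>i. i < length vs \<and> vs ! i = y"]
      by (auto simp: in_set_conv_nth)
    also have "\<dots> \<le> card (fst ` set ys)"
      using assms(1,2) by (metis card_mono distinct_card finite_imageI List.finite_set)
    finally show ?thesis using le by simp
  next
    case False
    then have "set vs \<subset> fst ` set ys" using assms(2,3) by force
    then have "length vs < card (fst ` set ys)"
      using assms(1) by (metis distinct_card finite_imageI List.finite_set psubset_card_mono)
    then show ?thesis using False le by (simp add: position_def)
  qed
qed

lemma legal_colours: "legal h ys \<Longrightarrow> (y, c) \<in> set ys \<Longrightarrow> 1 \<le> c \<and> c \<le> k"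
  by (induction ys arbitrary: h) auto

lemma accepts_complete:
  assumes "legal \<alpha> ys" "\<forall>w<n. recolour \<alpha> ys w = \<beta> w" "length ys = l"
  shows "\<exists>D. length D = l \<and> (\<forall>(i, c) \<in> set D. i < l \<and> 1 \<le> c \<and> c \<le> k) \<and> accepts D"
proof -
  define V where "V = fst (passes by_vertex ys (Suc l))"
  have V: "distinct V" "set V \<subseteq> fst ` set ys"
    using passes_vertices passes_scheduled[OF assms(1,2)] V_def by blast+
  have "accepts (indexed V ys)"
    using passes_indexed[OF V(1), of ys "Suc l" "[]"] passes_accept[OF assms(1,2)] assms(3)
    by (simp add: accepts_def V_def)
  moreover have "\<forall>(i, c) \<in> set (indexed V ys). i < l \<and> 1 \<le> c \<and> c \<le> k"
    using position_less[OF V] legal_colours[OF assms(1)] assms(3) by fastforce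
  ultimately show ?thesis using assms(3) by (intro exI[of _ "indexed V ys"]) auto
qed

lemma reachable_iff_accepts:
  assumes "\<forall>u<n. 1 \<le> \<beta> u \<and> \<beta> u \<le> k \<and> (\<forall>w<n. adj u w \<longrightarrow> \<beta> u \<noteq> \<beta> w)" "k \<ge> 1" "l \<ge> 1"
  shows "reachable \<longleftrightarrow>
    (\<exists>D. length D = l \<and> (\<forall>(i, c) \<in> set D. i < l \<and> 1 \<le> c \<and> c \<le> k) \<and> accepts D)"
proof
  assume reachable
  then obtain ys where ys: "length ys \<le> l" "legal \<alpha> ys" "\<forall>w<n. recolour \<alpha> ys w = \<beta> w"
    unfolding reachable_def by blast
  show "\<exists>D. length D = l \<and> (\<forall>(i, c) \<in> set D. i < l \<and> 1 \<le> c \<and> c \<le> k) \<and> accepts D"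
  \<comment> \<open>The padding below needs a vertex. Without vertices there is nothing to compare,
    so every schedule is accepted.\<close>
  proof (cases "n = 0")
    case True
    have "sim_pass by_index D [] = ([], True)" for D
    proof -
      have "fold (sim_step by_index) D (\<alpha>, [], True) = (\<alpha>, [], True)"
        by (induction D) auto
      moreover have "mark_if p n s = s" for p s using True by simp
      ultimately show ?thesis by (simp add: sim_pass_def sim_end_def)
    qed
    then have "passes by_index D (Suc j) = ([], True)" for D j
      by (induction j) (simp_all add: passes_Suc)
    then show ?thesis
      using assms(2,3) by (intro exI[of _ "replicate l (0, 1)"]) (auto simp: accepts_def)
  next
    case False
    define d where "d = l - length ys"
    \<comment> \<open>Once the target is reached, giving vertex 0 its target colour again is legal
      because \<beta> is proper; this pads the sequence to length \<open>l\<close>.\<close>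
    have "legal h (replicate d (0, \<beta> 0)) \<and> (\<forall>w<n. recolour h (replicate d (0, \<beta> 0)) w = \<beta> w)"
      if "\<forall>w<n. h w = \<beta> w" for h d
      using that
    proof (induction d arbitrary: h)
      case (Suc d)
      have "\<forall>w<n. adj 0 w \<longrightarrow> h w \<noteq> \<beta> 0" using assms(1) False Suc.prems by (metis gr0I)
      then show ?case
        using Suc.IH[of "h(0 := \<beta> 0)"] Suc.prems assms(1) False by (simp add: fun_upd_def)
    qed auto
    from this[OF ys(3), of d] show ?thesis
      using ys(1,2) by (intro accepts_complete[of "ys @ replicate d (0, \<beta> 0)"])
        (auto simp: legal_append recolour_append d_def)
  qed
next
  assume "\<exists>D. length D = l \<and> (\<forall>(i, c) \<in> set D. i < l \<and> 1 \<le> c \<and> c \<le> k) \<and> accepts D"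
  then show reachable using accepts_sound by fastforce
qed

end

section \<open>The program\<close>

definition keeps :: "nat set \<Rightarrow> (nat \<Rightarrow> nat) \<Rightarrow> (nat \<Rightarrow> nat) \<Rightarrow> bool" where
  "keeps A R R' \<longleftrightarrow> (\<forall>r. r \<notin> A \<longrightarrow> R' r = R r)"

lemma keeps_refl [simp]: "keeps A R R"
  by (simp add: keeps_def)

lemma keeps_upd: "keeps A R R' \<Longrightarrow> i \<in> A \<Longrightarrow> keeps A R (R'(i := x))"
  by (auto simp: keeps_def)

lemma keeps_trans: "keeps A R R' \<Longrightarrow> keeps B R' R'' \<Longrightarrow> A \<subseteq> C \<Longrightarrow> B \<subseteq> C \<Longrightarrow> keeps C R R''"
  unfolding keeps_def by (metis subsetD)

lemma keepsD: "keeps A R R' \<Longrightarrow> r \<notin> A \<Longrightarrow> R' r = R r"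
  by (simp add: keeps_def)

text \<open>
  Registers: 0 output, 2 \<open>n\<close>, 3 \<open>l\<close>, 4 \<open>k\<close>, 5 simulated colours, 6 discovery flags, 7 discovered
  vertices (5 to 7 are addresses), 8 guess, 9 undecoded rest of the guess, 10 number of discovered
  vertices, 11 no conflict so far, 14 \<open>l + 1\<close>, 17 index, 18 colour, 19 vertex, 20 running vertex,
  22 address of a matrix entry, 26 continue, 27 quotient, 28 adjacency matrix, 29 target colouring,
  30 source colouring (28 to 30 are addresses), 31 the constant 1; the others are loop counters and
  scratch.
\<close>

definition divide :: "nat \<Rightarrow> com" where
  "divide b = Block [Const 27 0, Add 23 9 31, Sub 23 23 b] ;;
     While_Nonzero 23 (Block [Sub 9 9 b, Add 27 27 31, Add 23 9 31, Sub 23 23 b])"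

text \<open>In truncated arithmetic \<open>R 9 + 1 - R b\<close> is nonzero iff
  \<open>R b \<le> R 9\<close>. The dividend itself is the variant, which overestimates the number
  of subtractions but keeps division out of the bound.\<close>

lemma runs_divide:
  assumes "R b > 0" "R 31 = 1" "b \<notin> {9, 23, 27}"
  shows "runs (divide b) (R, M) (R 9 * 6 + 4)
    (\<lambda>(R', M'). M' = M \<and> R' 9 = R 9 mod R b \<and> R' 27 = R 9 div R b \<and> keeps {9, 23, 27} R R')"
    (is "runs _ _ _ ?Q")
proof -
  define J where "J m s \<longleftrightarrow> snd s = M \<and> fst s 9 = m \<and> fst s 23 = Suc m - R b \<and>
    keeps {9, 23, 27} R (fst s) \<and> m mod R b = R 9 mod R b \<and> fst s 27 + m div R b = R 9 div R b"
    for m and s :: store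
  have "runs (While_Nonzero 23 (Block [Sub 9 9 b, Add 27 27 31, Add 23 9 31, Sub 23 23 b]))
    (R(27 := 0, 23 := Suc (R 9) - R b), M) (R 9 * (4 + 2) + 1) ?Q"
  proof (rule runs_While[where J = J])
    show "J (R 9) (R(27 := 0, 23 := Suc (R 9) - R b), M)"
      by (simp add: J_def keeps_def)
  next
    fix m and s :: store assume J: "J m s" "fst s 23 \<noteq> 0"
    obtain R' M' where s: "s = (R', M')" by force
    have R': "R' b = R b" "R' 31 = 1" "R' 9 = m" "R b \<le> m"
      using J assms by (auto simp: J_def s keeps_def)
    have "(m - R b) mod R b = m mod R b" "m div R b = Suc ((m - R b) div R b)"
      using R' assms(1) by (simp_all add: le_mod_geq le_div_geq)
    then have "J (m - R b) (R'(9 := m - R b, 27 := Suc (R' 27), 23 := Suc (m - R b) - R b), M')"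
      using J assms(3) by (simp add: J_def s keeps_def)
    moreover have "m - R b < m" using R' assms(1) by simp
    ultimately show "runs (Block [Sub 9 9 b, Add 27 27 31, Add 23 9 31, Sub 23 23 b]) s 4 (\<lambda>s'. \<exists>m'<m. J m' s')"
      using assms(3) R' by (intro runs_loop_free) (auto simp: s intro!: exI[of _ "m - R b"])
  next
    fix m and s :: store assume "J m s" "fst s 23 = 0"
    then show "?Q s"
      by (auto simp: J_def)
  qed
  then have "runs (Block [Const 27 0, Add 23 9 31, Sub 23 23 b]) (R, M) 3
    (\<lambda>s. runs (While_Nonzero 23 (Block [Sub 9 9 b, Add 27 27 31, Add 23 9 31, Sub 23 23 b])) s
      (R 9 * (4 + 2) + 1) ?Q)"
    using assms by (intro runs_loop_free[of "Block _"]) auto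
  then show ?thesis
    unfolding divide_def by (elim runs_Seq) simp
qed

definition mark_com :: com where
  "mark_com = Block [Const 11 0, Add 23 6 20, Load 24 23, Sub 25 31 24] ;;
     If_Nonzero 25 (Block [Store 23 31, Add 24 7 10, Store 24 20, Add 10 10 31])"

text \<open>Neighbours are read off a column of the symmetric matrix, since its start needs no multiplication.\<close>

definition conflict_test :: "instr list" where
  "conflict_test = [Load 23 22, Add 24 5 20, Load 24 24, Sub 25 24 18, Sub 24 18 24, Add 25 25 24,
     Sub 23 23 25, Add 22 22 2]"

text \<open>At most one of the two truncated differences is nonzero, so their sum is the distance of
  the two colours.\<close>

definition target_test :: "instr list" where
  "target_test = [Add 23 5 20, Load 23 23, Add 24 29 20, Load 24 24, Sub 25 23 24, Sub 24 24 23,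
     Add 23 25 24]"

definition mark_all :: "instr list \<Rightarrow> com" where
  "mark_all test = For 20 2 21 (Block test ;; If_Nonzero 23 mark_com)"

text \<open>Remainders modulo \<open>k\<close> are shifted by 1 to become colours. The last
  instruction prepares the test that follows: register 23 is nonzero iff the index lies inside the
  list.\<close>

definition decode_com :: com where
  "decode_com = divide 3 ;; Block [Const 17 0, Add 17 17 9, Const 9 0, Add 9 9 27] ;;
     divide 4 ;; Block [Add 18 9 31, Const 9 0, Add 9 9 27, Sub 23 10 17]"

definition recolour_com :: com where
  "recolour_com = Block [Add 23 7 17, Load 19 23, Add 22 28 19] ;; mark_all conflict_test ;;
     Block [Add 23 5 19, Store 23 18]"

definition step_com :: com where
  "step_com = decode_com ;; If_Nonzero 23 recolour_com"

text \<open>Decoding destroys register 9, so each pass copies the guess anew.\<close>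

definition pass_com :: com where
  "pass_com = Block [Const 11 1, Const 9 0, Add 9 9 8] ;;
     For 20 2 21 (Block [Add 23 30 20, Load 23 23, Add 24 5 20, Store 24 23]) ;;
     For 15 3 16 step_com ;; mark_all target_test"

text \<open>The search goes on while the guess is rejected and its undecoded rest is 0. A nonzero
  rest shows that the guess has reached \<open>(k * l) ^ l\<close>, a number that is thus never
  computed. Flags are cleared for each guess, whereas old list entries are cut off by the count in
  register 10.\<close>

definition guess_com :: com where
  "guess_com = Block [Const 10 0, Const 11 0] ;; For 20 2 21 (Block [Const 23 0, Add 24 6 20, Store 24 23]) ;;
     For 12 14 13 pass_com ;;
     Block [Const 0 0, Add 0 0 11, Sub 26 31 11, Sub 26 26 9, Add 8 8 31]"

text \<open>The size of the matrix is obtained by adding \<open>n\<close> repeatedly; the working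
  areas start directly behind the input.\<close>

definition init_com :: "nat \<Rightarrow> com" where
  "init_com k = Block [Const 31 1, Const 23 0, Load 2 23, Load 3 31, Const 4 k, Const 30 2, Add 29 30 2,
     Add 28 29 2, Add 14 3 31, Const 5 0, Add 5 5 28] ;; For 20 2 21 (Block [Add 5 5 2]) ;;
     Block [Add 6 5 2, Add 7 6 2, Const 8 0, Const 26 1]"

definition reconf_com :: "nat \<Rightarrow> com" where
  "reconf_com k = init_com k ;; While_Nonzero 26 guess_com"

section \<open>Memory layout and correctness of the program\<close>

context recolouring
begin

definition work :: nat where
  "work = 2 + 2 * n + n * n"

definition base :: "(nat \<Rightarrow> nat) \<Rightarrow> bool" where
  "base R \<longleftrightarrow> R 2 = n \<and> R 3 = l \<and> R 4 = k \<and> R 5 = work \<and> R 6 = work + n \<and> R 7 = work + 2 * n \<and>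
     R 14 = Suc l \<and> R 28 = 2 + 2 * n \<and> R 29 = 2 + n \<and> R 30 = 2 \<and> R 31 = 1"

text \<open>Offset \<open>u + w * n\<close> in the matrix is row \<open>w\<close> and column
  \<open>u\<close>, read here as \<open>adj u w\<close>: for fixed \<open>u\<close> the addresses
  are spaced by \<open>n\<close>.\<close>

definition input :: "(nat \<Rightarrow> nat) \<Rightarrow> bool" where
  "input M \<longleftrightarrow> (\<forall>w<n. M (2 + w) = \<alpha> w \<and> M (2 + n + w) = \<beta> w \<and>
     (\<forall>u<n. M (2 + 2 * n + u + w * n) = of_bool (adj u w)))"

text \<open>The prefix length \<open>j\<close> serves the loop that loads the source colouring;
  elsewhere it is \<open>n\<close>.\<close>

definition colours :: "nat \<Rightarrow> (nat \<Rightarrow> nat) \<Rightarrow> (nat \<Rightarrow> nat) \<Rightarrow> bool" where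
  "colours j g M \<longleftrightarrow> (\<forall>w<j. M (work + w) = g w)"

definition marked :: "nat list \<times> bool \<Rightarrow> (nat \<Rightarrow> nat) \<Rightarrow> (nat \<Rightarrow> nat) \<Rightarrow> bool" where
  "marked s R M \<longleftrightarrow> R 10 = length (fst s) \<and> R 11 = of_bool (snd s) \<and> set (fst s) \<subseteq> {..<n} \<and>
     (\<forall>w<n. M (work + n + w) = of_bool (w \<in> set (fst s))) \<and>
     (\<forall>i<length (fst s). M (work + 2 * n + i) = fst s ! i)"

lemma base_keeps:
  assumes "base R" "keeps A R R'" "A \<inter> {2, 3, 4, 5, 6, 7, 14, 28, 29, 30, 31} = {}"
  shows "base R'"
proof -
  have "R' r = R r" if "r \<in> {2, 3, 4, 5, 6, 7, 14, 28, 29, 30, 31}" for r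
    using assms(2,3) that by (meson disjoint_iff keepsD)
  then show ?thesis using assms(1) by (simp add: base_def)
qed

text \<open>The matrix ends just before \<open>work\<close>, where the working areas begin, so
  stores from there on leave the input intact.\<close>

lemma input_agree:
  assumes "input M" "\<forall>a<work. M' a = M a"
  shows "input M'"
proof -
  have "u + w * n < n * n" if "u < n" "w < n" for u w
  proof -
    have "u + w * n < Suc w * n" using that by simp
    also have "\<dots> \<le> n * n" using that by (intro mult_right_mono) auto
    finally show ?thesis .
  qed
  then have "2 + 2 * n + u + w * n < work" if "u < n" "w < n" for u w
    using that by (simp add: work_def add.assoc)
  then show ?thesis
    using assms by (simp add: input_def work_def)
qed

lemma runs_mark_com:
  assumes "base R" "marked s R M" "R 20 < n"
  shows "runs mark_com (R, M) 9 (\<lambda>(R', M'). marked (mark (R 20) s) R' M' \<and>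
    keeps {10, 11, 23, 24, 25} R R' \<and> (\<forall>a<work + n. M' a = M a))"
proof -
  obtain vs ok where s: "s = (vs, ok)" by force
  show ?thesis
  proof (cases "R 20 \<in> set vs")
    case True
    then show ?thesis
      using assms unfolding mark_com_def s
      by (intro runs_loop_free) (auto simp: marked_def base_def keeps_def)
  next
    case False
    then show ?thesis
      using assms unfolding mark_com_def s
      by (intro runs_loop_free) (auto simp: marked_def base_def keeps_def nth_append less_Suc_eq)
  qed
qed

text \<open>\<open>ptr\<close> describes register 22, which the test itself advances, as addresses
  of matrix entries cannot be multiplied out. The factor 23 is 8 for the test, 1 for the jump, 9 for
  marking and 5 for the loop.\<close>

lemma runs_mark_all:
  assumes "base R" "marked s R M" "R 22 = ptr 0" "length test \<le> 8"
    and test: "\<And>j R' M'. j < n \<Longrightarrow> R' 20 = j \<Longrightarrow> R' 22 = ptr j \<Longrightarrow> base R' \<Longrightarrow> \<forall>a<work + n. M' a = M a \<Longrightarrow>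
      keeps {10, 11, 20, 21, 22, 23, 24, 25} R R' \<Longrightarrow>
      \<exists>R''. fold effect test (R', M') = (R'', M') \<and> (R'' 23 \<noteq> 0 \<longleftrightarrow> p j) \<and> R'' 22 = ptr (Suc j) \<and>
        keeps {22, 23, 24, 25} R' R''"
  shows "runs (mark_all test) (R, M) (n * 23 + 3) (\<lambda>(R', M'). marked (mark_if p n s) R' M' \<and>
    keeps {10, 11, 20, 21, 22, 23, 24, 25} R R' \<and> (\<forall>a<work + n. M' a = M a))"
proof -
  let ?A = "{10, 11, 20, 21, 22, 23, 24, 25} :: nat set"
  define J where "J j R' M' \<longleftrightarrow> R' 22 = ptr j \<and> marked (mark_if p j s) R' M' \<and> keeps ?A R R' \<and>
    (\<forall>a<work + n. M' a = M a)" for j R' and M' :: "nat \<Rightarrow> nat"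
  have n: "R 2 = n" using assms(1) by (simp add: base_def)
  show ?thesis
    unfolding mark_all_def
  proof (rule runs_For[where J = J and T = 18])
    show "J 0 (R(20 := 0, 21 := R 2)) M"
      using assms(2,3) by (simp add: J_def marked_def keeps_def)
  next
    fix j R' M' assume j: "j < R 2" "J j R' M'" "R' 20 = j" "R' 2 = R 2"
    let ?Q = "\<lambda>(R'', M''). R'' 20 = j \<and> R'' 2 = R 2 \<and> J (Suc j) (R''(20 := Suc j, 21 := R 2 - Suc j)) M''"
    have keeps: "keeps ?A R R'" using j by (simp add: J_def)
    have b: "base R'" by (rule base_keeps[OF assms(1) keeps]) auto
    obtain R'' where R'': "fold effect test (R', M') = (R'', M')" "R'' 23 \<noteq> 0 \<longleftrightarrow> p j" "R'' 22 = ptr (Suc j)"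
        "keeps {22, 23, 24, 25} R' R''"
      using test[of j R' M'] j n b keeps by (auto simp: J_def)
    have b'': "base R''" by (rule base_keeps[OF b R''(4)]) auto
    have m: "marked (mark_if p j s) R'' M'"
      using j(2) R''(4) by (simp add: J_def marked_def keeps_def)
    have 20: "R'' 20 = j" "R'' 2 = R 2" using R''(4) j(3,4) by (simp_all add: keeps_def)
    have keeps'': "keeps ?A R R''" by (rule keeps_trans[OF keeps R''(4)]) auto
    have fin: "?Q (R3, M3)"
      if "marked (mark_if p (Suc j) s) R3 M3" "keeps {10, 11, 23, 24, 25} R'' R3" "\<forall>a<work + n. M3 a = M' a"
      for R3 M3
    proof -
      have "keeps ?A R R3" by (rule keeps_trans[OF keeps'' that(2)]) auto
      then have "keeps ?A R (R3(20 := Suc j, 21 := R 2 - Suc j))" by (simp add: keeps_upd)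
      moreover have "R3 20 = j" "R3 2 = R 2" "R3 22 = ptr (Suc j)"
        using that(2) 20 R''(3) by (simp_all add: keeps_def)
      ultimately show ?thesis
        using that(1,3) j(2) by (simp add: J_def marked_def)
    qed
    have "runs (If_Nonzero 23 mark_com) (R'', M') (Suc 9) ?Q"
    proof (rule runs_If)
      assume "fst (R'', M') 23 \<noteq> 0"
      then have "mark (R'' 20) (mark_if p j s) = mark_if p (Suc j) s"
        using R''(2) 20 by (simp add: mark_if_Suc)
      then have "runs mark_com (R'', M') 9 (\<lambda>(R3, M3). marked (mark_if p (Suc j) s) R3 M3 \<and>
          keeps {10, 11, 23, 24, 25} R'' R3 \<and> (\<forall>a<work + n. M3 a = M' a))"
        using runs_mark_com[OF b'' m] 20 j(1) n by simp
      then show "runs mark_com (R'', M') 9 ?Q"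
        by (rule runs_weaken_store) (rule fin, simp_all)
    next
      assume "fst (R'', M') 23 = 0"
      then have "mark_if p (Suc j) s = mark_if p j s" using R''(2) by (simp add: mark_if_Suc)
      then show "?Q (R'', M')" using m by (intro fin) auto
    qed
    then have "runs (Block test) (R', M') 8 (\<lambda>s. runs (If_Nonzero 23 mark_com) s (Suc 9) ?Q)"
      using R''(1) assms(4) by (intro runs_loop_free[of "Block _"]) auto
    then show "runs (Block test ;; If_Nonzero 23 mark_com) (R', M') 18 ?Q"
      by (rule runs_Seq) simp
  next
    fix R' M' assume "J (R 2) R' M'"
    then show "case (R', M') of (R', M') \<Rightarrow> marked (mark_if p n s) R' M' \<and> keeps ?A R R' \<and> (\<forall>a<work + n. M' a = M a)"
      using n by (simp add: J_def)
  qed (simp_all add: n)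
qed

definition rest :: "nat \<Rightarrow> nat \<Rightarrow> nat" where
  "rest G t = ((\<lambda>g. g div l div k) ^^ t) G"

text \<open>Mixed-radix digits of \<open>G\<close>, least significant first, alternately to base
  \<open>l\<close> and base \<open>k\<close>.\<close>

definition decode :: "nat \<Rightarrow> nat \<Rightarrow> (nat \<times> nat) list" where
  "decode G t = map (\<lambda>t. (rest G t mod l, rest G t div l mod k + 1)) [0..<t]"

lemma rest_0 [simp]: "rest G 0 = G"
  by (simp add: rest_def)

lemma rest_Suc: "rest G (Suc t) = rest G t div l div k"
  by (simp add: rest_def)

lemma rest_le: "rest G t \<le> G"
proof (induction t)
  case (Suc t)
  have "rest G t div l div k \<le> rest G t" by (meson div_le_dividend le_trans)
  then show ?case using Suc by (simp add: rest_Suc)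
qed simp

lemma decode_0 [simp]: "decode G 0 = []"
  by (simp add: decode_def)

lemma decode_Suc: "decode G (Suc t) = decode G t @ [(rest G t mod l, rest G t div l mod k + 1)]"
  by (simp add: decode_def)

lemma runs_decode_com:
  assumes "base R" "l > 0" "k > 0"
  shows "runs decode_com (R, M) (12 * R 9 + 16) (\<lambda>(R', M'). M' = M \<and> keeps {9, 17, 18, 23, 27} R R' \<and>
    R' 17 = R 9 mod l \<and> R' 18 = R 9 div l mod k + 1 \<and> R' 9 = R 9 div l div k \<and> R' 23 = R 10 - R 9 mod l)"
    (is "runs _ _ _ ?Q")
proof -
  have R: "R 3 = l" "R 4 = k" "R 31 = 1" using assms(1) by (simp_all add: base_def)
  have last: "runs (Block [Add 18 9 31, Const 9 0, Add 9 9 27, Sub 23 10 17]) (R', M) 4 ?Q"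
    if "R' 9 = R 9 div l mod k" "R' 27 = R 9 div l div k" "R' 17 = R 9 mod l" "keeps {9, 17, 23, 27} R R'" for R'
    using that R(3) by (intro runs_loop_free) (auto simp: keeps_def)
  have second: "runs (divide 4 ;; Block [Add 18 9 31, Const 9 0, Add 9 9 27, Sub 23 10 17]) (R', M)
      (R 9 * 6 + 4 + 4) ?Q"
    if "R' 9 = R 9 div l" "R' 17 = R 9 mod l" "keeps {9, 17, 23, 27} R R'" for R'
  proof (rule runs_Seq_store[OF runs_divide])
    show "R' 4 > 0" "R' 31 = 1" using that(3) R assms(3) by (simp_all add: keeps_def)
    show "R' 9 * 6 + 4 + 4 \<le> R 9 * 6 + 4 + 4" using that(1) by simp
    fix R'' M'' assume *: "M'' = M \<and> R'' 9 = R' 9 mod R' 4 \<and> R'' 27 = R' 9 div R' 4 \<and> keeps {9, 23, 27} R' R''"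
    have "runs (Block [Add 18 9 31, Const 9 0, Add 9 9 27, Sub 23 10 17]) (R'', M) 4 ?Q"
      using that R * by (intro last) (simp_all add: keeps_def)
    then show "runs (Block [Add 18 9 31, Const 9 0, Add 9 9 27, Sub 23 10 17]) (R'', M'') 4 ?Q"
      using * by simp
  qed simp_all
  show ?thesis
    unfolding decode_com_def
  proof (rule runs_Seq_store[OF runs_divide])
    show "R 3 > 0" "R 31 = 1" using R assms(2) by simp_all
    show "(R 9 * 6 + 4) + (R 9 * 6 + 12) \<le> 12 * R 9 + 16" by simp
    fix R' M' assume *: "M' = M \<and> R' 9 = R 9 mod R 3 \<and> R' 27 = R 9 div R 3 \<and> keeps {9, 23, 27} R R'"
    have "runs (divide 4 ;; Block [Add 18 9 31, Const 9 0, Add 9 9 27, Sub 23 10 17])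
      (R'(17 := R' 9, 9 := R' 27), M) (R 9 * 6 + 4 + 4) ?Q"
      using * R by (intro second) (simp_all add: keeps_def)
    then have "runs (Block [Const 17 0, Add 17 17 9, Const 9 0, Add 9 9 27]) (R', M') 4
      (\<lambda>s. runs (divide 4 ;; Block [Add 18 9 31, Const 9 0, Add 9 9 27, Sub 23 10 17]) s (R 9 * 6 + 4 + 4) ?Q)"
      using * by (intro runs_loop_free[of "Block _"]) auto
    then show "runs (Block [Const 17 0, Add 17 17 9, Const 9 0, Add 9 9 27] ;;
        divide 4 ;; Block [Add 18 9 31, Const 9 0, Add 9 9 27, Sub 23 10 17]) (R', M') (R 9 * 6 + 12) ?Q"
      by (rule runs_Seq) simp
  qed simp_all
qed

definition simulated :: "simulation_state \<Rightarrow> (nat \<Rightarrow> nat) \<Rightarrow> (nat \<Rightarrow> nat) \<Rightarrow> bool" where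
  "simulated S R M \<longleftrightarrow> marked (snd S) R M \<and> colours n (fst S) M \<and> input M"

lemma marked_keeps: "marked s R M \<Longrightarrow> keeps A R R' \<Longrightarrow> 10 \<notin> A \<Longrightarrow> 11 \<notin> A \<Longrightarrow> marked s R' M"
  by (simp add: marked_def keeps_def)

lemma colours_agree: "colours n g M \<Longrightarrow> \<forall>a<work + n. M' a = M a \<Longrightarrow> colours n g M'"
  by (simp add: colours_def)

lemma runs_recolour_com:
  assumes "base R" "simulated (g, vs, ok) R M" "R 17 < length vs"
  shows "runs recolour_com (R, M) (n * 23 + 8) (\<lambda>(R', M').
    simulated (sim_step by_index (R 17, R 18) (g, vs, ok)) R' M' \<and>
    keeps {10, 11, 19, 20, 21, 22, 23, 24, 25} R R')" (is "runs _ _ _ ?Q")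
proof -
  define u where "u = vs ! R 17"
  let ?p = "\<lambda>w. adj u w \<and> g w = R 18"
  let ?R = "R(23 := work + 2 * n + R 17, 19 := u, 22 := 2 + 2 * n + u)"
  have M: "marked (vs, ok) R M" "colours n g M" "input M" using assms(2) by (simp_all add: simulated_def)
  have u: "u < n" "M (work + 2 * n + R 17) = u"
    using M(1) assms(3) subsetD[OF _ nth_mem[OF assms(3)], of "{..<n}"] by (simp_all add: marked_def u_def)
  have b: "base ?R" using assms(1) by (simp add: base_def)
  have "runs (mark_all conflict_test) (?R, M) (n * 23 + 3) (\<lambda>(R', M').
    marked (mark_if ?p n (vs, ok)) R' M' \<and> keeps {10, 11, 20, 21, 22, 23, 24, 25} ?R R' \<and>
    (\<forall>a<work + n. M' a = M a))"
  proof (rule runs_mark_all[where ptr = "\<lambda>j. 2 + 2 * n + u + j * n"])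
    show "base ?R" by (rule b)
    show "marked (vs, ok) ?R M" using M(1) by (simp add: marked_def)
    fix j R' M'
    assume *: "j < n" "R' 20 = j" "R' 22 = 2 + 2 * n + u + j * n" "base R'" "\<forall>a<work + n. M' a = M a"
      "keeps {10, 11, 20, 21, 22, 23, 24, 25} ?R R'"
    have "input M'" by (rule input_agree[OF M(3)]) (use *(5) in simp)
    then have "M' (2 + 2 * n + u + j * n) = of_bool (adj u j)" using *(1) u(1) by (simp add: input_def)
    moreover have "M' (work + j) = g j" using colours_agree[OF M(2) *(5)] *(1) by (simp add: colours_def)
    moreover have "R' 18 = R 18" using *(6) by (simp add: keeps_def)
    \<comment> \<open>The matrix entry, 0 or 1, minus the distance of the two colours is nonzero iff
      the entry is 1 and the colours agree.\<close>
    ultimately show "\<exists>R''. fold effect conflict_test (R', M') = (R'', M') \<and> (R'' 23 \<noteq> 0 \<longleftrightarrow> ?p j) \<and>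
        R'' 22 = 2 + 2 * n + u + Suc j * n \<and> keeps {22, 23, 24, 25} R' R''"
      using *(2-4) by (auto simp: conflict_test_def base_def keeps_def)
  qed (simp_all add: conflict_test_def)
  then have "runs (mark_all conflict_test ;; Block [Add 23 5 19, Store 23 18]) (?R, M) (n * 23 + 5) ?Q"
  proof (rule runs_Seq_store)
    fix R' M'
    assume *: "marked (mark_if ?p n (vs, ok)) R' M' \<and> keeps {10, 11, 20, 21, 22, 23, 24, 25} ?R R' \<and>
      (\<forall>a<work + n. M' a = M a)"
    \<comment> \<open>The new colour is stored only after the scan, as conflicts refer to the
      colouring before the move.\<close>
    let ?M = "M'(work + u := R 18)"
    have "marked (mark_if ?p n (vs, ok)) (R'(23 := work + u)) ?M"
      using * u(1) by (simp add: marked_def)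
    moreover have "colours n (g(u := R 18)) ?M"
      using colours_agree[OF M(2), of M'] * by (simp add: colours_def)
    moreover have "input ?M" by (rule input_agree[OF M(3)]) (use * in simp)
    ultimately have "simulated (sim_step by_index (R 17, R 18) (g, vs, ok)) (R'(23 := work + u)) ?M"
      using assms(3) by (simp add: simulated_def u_def)
    moreover have "keeps {10, 11, 19, 20, 21, 22, 23, 24, 25} R (R'(23 := work + u))"
      using * by (simp add: keeps_def)
    moreover have "R' 5 = work" "R' 19 = u" "R' 18 = R 18"
      using * assms(1) by (simp_all add: keeps_def base_def)
    ultimately show "runs (Block [Add 23 5 19, Store 23 18]) (R', M') 2 ?Q"
      by (intro runs_loop_free) auto
  qed simp
  then have "runs (Block [Add 23 7 17, Load 19 23, Add 22 28 19]) (R, M) 3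
    (\<lambda>s. runs (mark_all conflict_test ;; Block [Add 23 5 19, Store 23 18]) s (n * 23 + 5) ?Q)"
    using assms(1) u(2) by (intro runs_loop_free[of "Block _"]) (auto simp: base_def)
  then show ?thesis
    unfolding recolour_com_def by (rule runs_Seq) simp
qed

lemma runs_step_com:
  assumes "base R" "simulated S R M" "l > 0" "k > 0"
  shows "runs step_com (R, M) (12 * R 9 + n * 23 + 25) (\<lambda>(R', M').
    simulated (sim_step by_index (R 9 mod l, R 9 div l mod k + 1) S) R' M' \<and>
    R' 9 = R 9 div l div k \<and> keeps {9, 10, 11, 17, 18, 19, 20, 21, 22, 23, 24, 25, 27} R R')"
    (is "runs _ _ _ ?Q")
  unfolding step_com_def
proof (rule runs_Seq_store[OF runs_decode_com[OF assms(1,3,4)]])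
  fix R' M'
  assume *: "M' = M \<and> keeps {9, 17, 18, 23, 27} R R' \<and>
    R' 17 = R 9 mod l \<and> R' 18 = R 9 div l mod k + 1 \<and> R' 9 = R 9 div l div k \<and> R' 23 = R 10 - R 9 mod l"
  obtain g vs ok where S: "S = (g, vs, ok)" by (metis prod_cases3)
  have 10: "R 10 = length vs" using assms(2) by (simp add: simulated_def marked_def S)
  have keeps: "keeps {9, 17, 18, 23, 27} R R'" using * by simp
  have b: "base R'" by (rule base_keeps[OF assms(1) keeps]) auto
  have sim: "simulated S R' M'"
    using assms(2) * marked_keeps[OF _ keeps] by (simp add: simulated_def)
  show "runs (If_Nonzero 23 recolour_com) (R', M') (Suc (n * 23 + 8)) ?Q"
  proof (rule runs_If)
    assume "fst (R', M') 23 \<noteq> 0"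
    then have "R' 17 < length vs" using * 10 by simp
    from runs_recolour_com[OF b sim[unfolded S] this] show "runs recolour_com (R', M') (n * 23 + 8) ?Q"
    proof (rule runs_weaken_store)
      fix R'' M''
      assume **: "simulated (sim_step by_index (R' 17, R' 18) (g, vs, ok)) R'' M'' \<and>
        keeps {10, 11, 19, 20, 21, 22, 23, 24, 25} R' R''"
      have "keeps {9, 10, 11, 17, 18, 19, 20, 21, 22, 23, 24, 25, 27} R R''"
        by (rule keeps_trans[OF keeps conjunct2[OF **]]) auto
      moreover have "R'' 9 = R' 9" using ** by (simp add: keeps_def)
      ultimately show "?Q (R'', M'')"
        using * ** by (simp add: S del: sim_step.simps)
    qed simp
  next
    assume "fst (R', M') 23 = 0"
    then have "\<not> R 9 mod l < length vs" using * 10 by simp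
    moreover have "keeps {9, 10, 11, 17, 18, 19, 20, 21, 22, 23, 24, 25, 27} R R'"
      by (rule keeps_trans[OF keeps keeps_refl[of "{}"]]) auto
    ultimately show "?Q (R', M')" using sim * by (simp add: S)
  qed
qed simp

lemma runs_pass_com:
  assumes "base R" "marked s R M" "input M" "l > 0" "k > 0"
  shows "runs pass_com (R, M) (l * (12 * R 8 + n * 23 + 30) + n * 32 + 12) (\<lambda>(R', M').
    marked (sim_pass by_index (decode (R 8) l) (fst s)) R' M' \<and> input M' \<and> R' 9 = rest (R 8) l \<and>
    keeps {9, 10, 11, 15, 16, 17, 18, 19, 20, 21, 22, 23, 24, 25, 27} R R')" (is "runs _ _ _ ?Q")
proof -
  let ?A = "{9, 10, 11, 15, 16, 17, 18, 19, 20, 21, 22, 23, 24, 25, 27} :: nat set"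
  let ?load = "For 20 2 21 (Block [Add 23 30 20, Load 23 23, Add 24 5 20, Store 24 23])"
  let ?S = "\<lambda>j. fold (sim_step by_index) (decode (R 8) j) (\<alpha>, fst s, True)"
  have compare: "runs (mark_all target_test) (R', M') (n * 23 + 3) ?Q"
    if "simulated (?S l) R' M'" "R' 9 = rest (R 8) l" "keeps ?A R R'" for R' M'
  proof -
    obtain g' s' where S: "?S l = (g', s')" by (rule prod.exhaust)
    have M': "marked s' R' M'" "colours n g' M'" "input M'" using that(1) by (simp_all add: simulated_def S)
    have b: "base R'" by (rule base_keeps[OF assms(1) that(3)]) auto
    have "runs (mark_all target_test) (R', M') (n * 23 + 3) (\<lambda>(R'', M'').
      marked (mark_if (\<lambda>w. g' w \<noteq> \<beta> w) n s') R'' M'' \<and> keeps {10, 11, 20, 21, 22, 23, 24, 25} R' R'' \<and>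
      (\<forall>a<work + n. M'' a = M' a))"
    proof (rule runs_mark_all[where ptr = "\<lambda>_. R' 22"])
      fix j R'' M''
      assume *: "j < n" "R'' 20 = j" "R'' 22 = R' 22" "base R''" "\<forall>a<work + n. M'' a = M' a"
      have "input M''" by (rule input_agree[OF M'(3)]) (use *(5) in simp)
      then have "M'' (2 + n + j) = \<beta> j" using *(1) by (simp add: input_def)
      moreover have "M'' (work + j) = g' j" using colours_agree[OF M'(2) *(5)] *(1) by (simp add: colours_def)
      ultimately show "\<exists>R3. fold effect target_test (R'', M'') = (R3, M'') \<and> (R3 23 \<noteq> 0 \<longleftrightarrow> g' j \<noteq> \<beta> j) \<and>
          R3 22 = R' 22 \<and> keeps {22, 23, 24, 25} R'' R3"
        using *(2-4) by (auto simp: target_test_def base_def keeps_def)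
    qed (use b M' in \<open>simp_all add: target_test_def\<close>)
    then show ?thesis
    proof (rule runs_weaken_store)
      fix R'' M''
      assume *: "marked (mark_if (\<lambda>w. g' w \<noteq> \<beta> w) n s') R'' M'' \<and> keeps {10, 11, 20, 21, 22, 23, 24, 25} R' R'' \<and>
        (\<forall>a<work + n. M'' a = M' a)"
      have "keeps ?A R R''" by (rule keeps_trans[OF that(3) conjunct1[OF conjunct2[OF *]]]) auto
      moreover have "input M''" by (rule input_agree[OF M'(3)]) (use * in simp)
      moreover have "R'' 9 = R' 9" using * by (simp add: keeps_def)
      ultimately show "?Q (R'', M'')"
        using * that(2) by (simp add: sim_pass_def sim_end_def S)
    qed simp
  qed
  have steps: "runs (For 15 3 16 step_com) (R', M') (l * (12 * R 8 + n * 23 + 30) + 3) (\<lambda>(R', M').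
      simulated (?S l) R' M' \<and> R' 9 = rest (R 8) l \<and> keeps ?A R R')"
    if sim: "simulated (\<alpha>, fst s, True) R' M'" and 9: "R' 9 = R 8" and keeps: "keeps ?A R R'" for R' M'
  proof -
    define J where "J j R2 M2 \<longleftrightarrow> simulated (?S j) R2 M2 \<and> R2 9 = rest (R 8) j \<and> keeps ?A R R2" for j R2 M2
    have R'3: "R' 3 = l" using keeps assms(1) by (simp add: keeps_def base_def)
    show ?thesis
    proof (rule runs_For[where J = J and T = "12 * R 8 + n * 23 + 25"])
      show "J 0 (R'(15 := 0, 16 := R' 3)) M'"
        using sim 9 keeps by (simp add: J_def simulated_def marked_def keeps_upd)
    next
      fix j R2 M2 assume j: "J j R2 M2" "R2 15 = j" "R2 3 = R' 3"
      have J: "simulated (?S j) R2 M2" "R2 9 = rest (R 8) j" "keeps ?A R R2" using j(1) by (simp_all add: J_def)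
      have b: "base R2" by (rule base_keeps[OF assms(1) J(3)]) auto
      show "runs step_com (R2, M2) (12 * R 8 + n * 23 + 25) (\<lambda>(R3, M3). R3 15 = j \<and> R3 3 = R' 3 \<and>
          J (Suc j) (R3(15 := Suc j, 16 := R' 3 - Suc j)) M3)"
      proof (rule runs_weaken_store[OF runs_step_com[OF b J(1) assms(4,5)]])
        \<comment> \<open>The rest only shrinks, so each step is charged as if it decoded the whole
          guess.\<close>
        show "12 * R2 9 + n * 23 + 25 \<le> 12 * R 8 + n * 23 + 25" using J(2) rest_le by simp
        fix R3 M3
        assume *: "simulated (sim_step by_index (R2 9 mod l, R2 9 div l mod k + 1) (?S j)) R3 M3 \<and>
          R3 9 = R2 9 div l div k \<and> keeps {9, 10, 11, 17, 18, 19, 20, 21, 22, 23, 24, 25, 27} R2 R3"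
        have "keeps ?A R R3" by (rule keeps_trans[OF J(3) conjunct2[OF conjunct2[OF *]]]) auto
        then have "keeps ?A R (R3(15 := Suc j, 16 := R' 3 - Suc j))" by (simp add: keeps_upd)
        moreover have "simulated (?S (Suc j)) R3 M3" using * J(2) by (simp add: decode_Suc)
        moreover have "R3 15 = j" "R3 3 = R' 3" using * j(2,3) by (simp_all add: keeps_def)
        ultimately show "case (R3, M3) of (R3, M3) \<Rightarrow> R3 15 = j \<and> R3 3 = R' 3 \<and>
            J (Suc j) (R3(15 := Suc j, 16 := R' 3 - Suc j)) M3"
          using * J(2) by (simp add: J_def simulated_def marked_def rest_Suc)
      qed
    next
      fix R2 M2 assume "J (R' 3) R2 M2"
      then show "case (R2, M2) of (R', M') \<Rightarrow> simulated (?S l) R' M' \<and> R' 9 = rest (R 8) l \<and> keeps ?A R R'"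
        using R'3 by (simp add: J_def)
    qed (simp_all add: R'3)
  qed
  have load: "runs ?load (R', M) (n * 9 + 3) (\<lambda>(R', M').
      simulated (\<alpha>, fst s, True) R' M' \<and> R' 9 = R 8 \<and> keeps ?A R R')"
    if m: "marked (fst s, True) R' M" and 9: "R' 9 = R 8" and keeps: "keeps ?A R R'" for R'
  proof -
    define J where "J j R2 M2 \<longleftrightarrow> marked (fst s, True) R2 M2 \<and> colours j \<alpha> M2 \<and> input M2 \<and> R2 9 = R 8 \<and>
      keeps ?A R R2" for j R2 M2
    have R'2: "R' 2 = n" using keeps assms(1) by (simp add: keeps_def base_def)
    show ?thesis
    proof (rule runs_For[where J = J and T = 4])
      show "J 0 (R'(20 := 0, 21 := R' 2)) M"
        using m 9 keeps assms(3) by (simp add: J_def marked_def keeps_upd colours_def)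
    next
      fix j R2 M2 assume j: "j < R' 2" "J j R2 M2" "R2 20 = j" "R2 2 = R' 2"
      have J: "marked (fst s, True) R2 M2" "colours j \<alpha> M2" "input M2" "R2 9 = R 8" "keeps ?A R R2"
        using j(2) by (simp_all add: J_def)
      have b: "base R2" by (rule base_keeps[OF assms(1) J(5)]) auto
      let ?R = "R2(23 := \<alpha> j, 24 := work + j)" and ?M = "M2(work + j := \<alpha> j)"
      have "keeps ?A R (?R(20 := Suc j, 21 := n - Suc j))" using J(5) by (simp add: keeps_upd)
      moreover have "colours (Suc j) \<alpha> ?M" using J(2) by (simp add: colours_def less_Suc_eq)
      moreover have "input ?M" by (rule input_agree[OF J(3)]) simp
      moreover have "marked (fst s, True) (?R(20 := Suc j, 21 := n - Suc j)) ?M"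
        using J(1) j(1) R'2 by (simp add: marked_def)
      ultimately have "J (Suc j) (?R(20 := Suc j, 21 := n - Suc j)) ?M" using J(4) by (simp add: J_def)
      moreover have "R2 30 = 2" "R2 5 = work" "M2 (2 + j) = \<alpha> j"
        using b J(3) j(1) R'2 by (simp_all add: base_def input_def)
      ultimately show "runs (Block [Add 23 30 20, Load 23 23, Add 24 5 20, Store 24 23]) (R2, M2) 4
          (\<lambda>(R3, M3). R3 20 = j \<and> R3 2 = R' 2 \<and> J (Suc j) (R3(20 := Suc j, 21 := R' 2 - Suc j)) M3)"
        using j(3,4) R'2 by (intro runs_loop_free) (auto simp: fun_upd_twist)
    next
      fix R2 M2 assume "J (R' 2) R2 M2"
      then show "case (R2, M2) of (R', M') \<Rightarrow> simulated (\<alpha>, fst s, True) R' M' \<and> R' 9 = R 8 \<and> keeps ?A R R'"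
        using R'2 by (simp add: J_def simulated_def)
    qed (simp_all add: R'2)
  qed
  have tail: "runs (?load ;; For 15 3 16 step_com ;; mark_all target_test) (R(11 := 1, 9 := R 8), M)
      (l * (12 * R 8 + n * 23 + 30) + n * 32 + 9) ?Q"
  proof (rule runs_Seq_store[OF load])
    show "marked (fst s, True) (R(11 := 1, 9 := R 8)) M" using assms(2) by (simp add: marked_def)
    show "keeps ?A R (R(11 := 1, 9 := R 8))" by (simp add: keeps_upd)
    fix R' M' assume *: "simulated (\<alpha>, fst s, True) R' M' \<and> R' 9 = R 8 \<and> keeps ?A R R'"
    show "runs (For 15 3 16 step_com ;; mark_all target_test) (R', M')
        (l * (12 * R 8 + n * 23 + 30) + n * 23 + 6) ?Q"
    proof (rule runs_Seq_store[OF steps])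
      fix R2 M2 assume "simulated (?S l) R2 M2 \<and> R2 9 = rest (R 8) l \<and> keeps ?A R R2"
      then show "runs (mark_all target_test) (R2, M2) (n * 23 + 3) ?Q" by (intro compare) simp_all
    qed (use * in simp_all)
  qed simp_all
  then have "runs (Block [Const 11 1, Const 9 0, Add 9 9 8]) (R, M) 3
    (\<lambda>s. runs (?load ;; For 15 3 16 step_com ;; mark_all target_test) s
      (l * (12 * R 8 + n * 23 + 30) + n * 32 + 9) ?Q)"
    by (intro runs_loop_free[of "Block _"]) (auto simp: fun_upd_twist)
  then show ?thesis
    unfolding pass_com_def by (rule runs_Seq) simp
qed

definition pass_time :: "nat \<Rightarrow> nat" where
  "pass_time G = l * (12 * G + n * 23 + 30) + n * 32 + 12"

definition guess_time :: "nat \<Rightarrow> nat" where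
  "guess_time G = Suc l * (pass_time G + 5) + n * 8 + 13"

lemma runs_guess_com:
  assumes "base R" "input M" "l > 0" "k > 0"
  shows "runs guess_com (R, M) (guess_time (R 8)) (\<lambda>(R', M'). base R' \<and> input M' \<and> R' 8 = Suc (R 8) \<and>
    R' 0 = of_bool (accepts (decode (R 8) l)) \<and>
    R' 26 = 1 - of_bool (accepts (decode (R 8) l)) - rest (R 8) l)" (is "runs _ _ _ ?Q")
proof -
  let ?A = "{9, 10, 11, 12, 13, 15, 16, 17, 18, 19, 20, 21, 22, 23, 24, 25, 27} :: nat set"
  let ?reset = "For 20 2 21 (Block [Const 23 0, Add 24 6 20, Store 24 23])"
  let ?finish = "Block [Const 0 0, Add 0 0 11, Sub 26 31 11, Sub 26 26 9, Add 8 8 31]"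
  let ?D = "decode (R 8) l"
  have finish: "runs ?finish (R', M') 5 ?Q"
    if "marked (passes by_index ?D (Suc l)) R' M'" "input M'" "R' 9 = rest (R 8) l" "keeps ?A R R'" for R' M'
  proof -
    have b: "base R'" by (rule base_keeps[OF assms(1) that(4)]) auto
    have "R' 8 = R 8" using that(4) by (simp add: keeps_def)
    moreover have "R' 11 = of_bool (accepts ?D)" using that(1) by (simp add: marked_def accepts_def)
    ultimately show ?thesis
      using b that(2,3) by (intro runs_loop_free) (auto simp: base_def)
  qed
  have passes: "runs (For 12 14 13 pass_com) (R', M') (Suc l * (pass_time (R 8) + 5) + 3) (\<lambda>(R', M').
      marked (passes by_index ?D (Suc l)) R' M' \<and> input M' \<and> R' 9 = rest (R 8) l \<and> keeps ?A R R')"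
    if m: "marked ([], False) R' M'" and i: "input M'" and keeps: "keeps ?A R R'" for R' M'
  proof -
    \<comment> \<open>Register 9 holds the final rest only after a first pass; the guard
      \<open>j > 0\<close> is met at the end because there are \<open>Suc l\<close> passes.\<close>
    define J where "J j R2 M2 \<longleftrightarrow> marked (passes by_index ?D j) R2 M2 \<and> input M2 \<and>
      (j > 0 \<longrightarrow> R2 9 = rest (R 8) l) \<and> keeps ?A R R2" for j R2 M2
    have R'14: "R' 14 = Suc l" using keeps assms(1) by (simp add: keeps_def base_def)
    show ?thesis
    proof (rule runs_For[where J = J and T = "pass_time (R 8)"])
      show "J 0 (R'(12 := 0, 13 := R' 14)) M'"
        using m i keeps by (simp add: J_def marked_def keeps_upd)
    next
      fix j R2 M2 assume j: "J j R2 M2" "R2 12 = j" "R2 14 = R' 14"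
      have J: "marked (passes by_index ?D j) R2 M2" "input M2" "keeps ?A R R2" using j(1) by (simp_all add: J_def)
      have b: "base R2" by (rule base_keeps[OF assms(1) J(3)]) auto
      have 8: "R2 8 = R 8" using J(3) by (simp add: keeps_def)
      show "runs pass_com (R2, M2) (pass_time (R 8)) (\<lambda>(R3, M3). R3 12 = j \<and> R3 14 = R' 14 \<and>
          J (Suc j) (R3(12 := Suc j, 13 := R' 14 - Suc j)) M3)"
      proof (rule runs_weaken_store[OF runs_pass_com[OF b J(1,2) assms(3,4)]])
        show "l * (12 * R2 8 + n * 23 + 30) + n * 32 + 12 \<le> pass_time (R 8)" using 8 by (simp add: pass_time_def)
        fix R3 M3
        assume *: "marked (sim_pass by_index (decode (R2 8) l) (fst (passes by_index ?D j))) R3 M3 \<and> input M3 \<and>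
          R3 9 = rest (R2 8) l \<and> keeps {9, 10, 11, 15, 16, 17, 18, 19, 20, 21, 22, 23, 24, 25, 27} R2 R3"
        have "keeps ?A R R3" by (rule keeps_trans[OF J(3) conjunct2[OF conjunct2[OF conjunct2[OF *]]]]) auto
        then have "keeps ?A R (R3(12 := Suc j, 13 := R' 14 - Suc j))" by (simp add: keeps_upd)
        moreover have "marked (passes by_index ?D (Suc j)) R3 M3" using * 8 by (simp add: passes_Suc)
        moreover have "R3 12 = j" "R3 14 = R' 14" using * j(2,3) by (simp_all add: keeps_def)
        ultimately show "case (R3, M3) of (R3, M3) \<Rightarrow> R3 12 = j \<and> R3 14 = R' 14 \<and>
            J (Suc j) (R3(12 := Suc j, 13 := R' 14 - Suc j)) M3"
          using * 8 by (simp add: J_def marked_def)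
      qed
    next
      fix R2 M2 assume "J (R' 14) R2 M2"
      then show "case (R2, M2) of (R', M') \<Rightarrow> marked (passes by_index ?D (Suc l)) R' M' \<and> input M' \<and>
          R' 9 = rest (R 8) l \<and> keeps ?A R R'"
        using R'14 by (simp add: J_def)
    qed (simp_all add: R'14)
  qed
  have reset: "runs ?reset (R(10 := 0, 11 := 0), M) (n * 8 + 3) (\<lambda>(R', M').
      marked ([], False) R' M' \<and> input M' \<and> keeps ?A R R')"
  proof -
    define J where "J j R2 M2 \<longleftrightarrow> (\<forall>w<j. M2 (work + n + w) = 0) \<and> R2 10 = 0 \<and> R2 11 = 0 \<and> input M2 \<and>
      keeps ?A R R2" for j R2 M2
    have R2: "(R(10 := 0, 11 := 0)) 2 = n" using assms(1) by (simp add: base_def)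
    show ?thesis
    proof (rule runs_For[where J = J and T = 3])
      show "J 0 ((R(10 := 0, 11 := 0))(20 := 0, 21 := (R(10 := 0, 11 := 0)) 2)) M"
        using assms(2) by (simp add: J_def keeps_upd)
    next
      fix j R2 M2
      assume j: "j < (R(10 := 0, 11 := 0)) 2" "J j R2 M2" "R2 20 = j" "R2 2 = (R(10 := 0, 11 := 0)) 2"
      have J: "\<forall>w<j. M2 (work + n + w) = 0" "R2 10 = 0" "R2 11 = 0" "input M2" "keeps ?A R R2"
        using j(2) by (simp_all add: J_def)
      have b: "base R2" by (rule base_keeps[OF assms(1) J(5)]) auto
      let ?R = "R2(23 := 0, 24 := work + n + j)" and ?M = "M2(work + n + j := 0)"
      have "keeps ?A R (?R(20 := Suc j, 21 := n - Suc j))" using J(5) by (simp add: keeps_upd)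
      moreover have "input ?M" by (rule input_agree[OF J(4)]) simp
      ultimately have "J (Suc j) (?R(20 := Suc j, 21 := n - Suc j)) ?M"
        using J(1-3) by (simp add: J_def less_Suc_eq)
      moreover have "R2 6 = work + n" using b by (simp add: base_def)
      ultimately show "runs (Block [Const 23 0, Add 24 6 20, Store 24 23]) (R2, M2) 3 (\<lambda>(R3, M3). R3 20 = j \<and>
          R3 2 = (R(10 := 0, 11 := 0)) 2 \<and>
          J (Suc j) (R3(20 := Suc j, 21 := (R(10 := 0, 11 := 0)) 2 - Suc j)) M3)"
        unfolding R2 using j(3,4) R2 by (intro runs_loop_free) (auto simp: fun_upd_twist)
    next
      fix R2 M2 assume "J ((R(10 := 0, 11 := 0)) 2) R2 M2"
      then show "case (R2, M2) of (R', M') \<Rightarrow> marked ([], False) R' M' \<and> input M' \<and> keeps ?A R R'"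
        unfolding R2 by (simp add: J_def marked_def)
    qed (use assms(1) in \<open>simp_all add: base_def\<close>)
  qed
  have "runs (?reset ;; For 12 14 13 pass_com ;; ?finish) (R(10 := 0, 11 := 0), M)
      (Suc l * (pass_time (R 8) + 5) + n * 8 + 11) ?Q"
  proof (rule runs_Seq_store[OF reset])
    fix R' M' assume *: "marked ([], False) R' M' \<and> input M' \<and> keeps ?A R R'"
    show "runs (For 12 14 13 pass_com ;; ?finish) (R', M') (Suc l * (pass_time (R 8) + 5) + 8) ?Q"
    proof (rule runs_Seq_store[OF passes])
      fix R2 M2
      assume "marked (passes by_index ?D (Suc l)) R2 M2 \<and> input M2 \<and> R2 9 = rest (R 8) l \<and> keeps ?A R R2"
      then show "runs ?finish (R2, M2) 5 ?Q" by (intro finish) simp_all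
    qed (use * in simp_all)
  qed simp
  then have "runs (Block [Const 10 0, Const 11 0]) (R, M) 2
    (\<lambda>s. runs (?reset ;; For 12 14 13 pass_com ;; ?finish) s
      (Suc l * (pass_time (R 8) + 5) + n * 8 + 11) ?Q)"
    by (intro runs_loop_free[of "Block _"]) auto
  then show ?thesis
    unfolding guess_com_def guess_time_def by (rule runs_Seq) simp
qed

lemma runs_init_com:
  assumes "M 0 = n" "M 1 = l"
  shows "runs (init_com k) (R, M) (n * 6 + 18) (\<lambda>(R', M'). M' = M \<and> base R' \<and> R' 8 = 0 \<and> R' 26 = 1)"
    (is "runs _ _ _ ?Q")
proof -
  let ?finish = "Block [Add 6 5 2, Add 7 6 2, Const 8 0, Const 26 1]"
  define regs where "regs R \<longleftrightarrow> R 2 = n \<and> R 3 = l \<and> R 4 = k \<and> R 14 = Suc l \<and> R 28 = 2 + 2 * n \<and>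
    R 29 = 2 + n \<and> R 30 = 2 \<and> R 31 = 1" for R :: "nat \<Rightarrow> nat"
  have finish: "runs ?finish (R', M) 4 ?Q" if "regs R'" "R' 5 = work" for R'
    using that by (intro runs_loop_free) (auto simp: regs_def base_def)
  have square: "runs (For 20 2 21 (Block [Add 5 5 2])) (R', M) (n * 6 + 3)
      (\<lambda>(R', M'). M' = M \<and> regs R' \<and> R' 5 = work)" if "regs R'" "R' 5 = 2 + 2 * n" for R'
  proof -
    have R'2: "R' 2 = n" using that by (simp add: regs_def)
    show ?thesis
    proof (rule runs_For[where J = "\<lambda>j R2 M2. M2 = M \<and> regs R2 \<and> R2 5 = 2 + 2 * n + j * n" and T = 1])
      fix j R2 M2 assume "M2 = M \<and> regs R2 \<and> R2 5 = 2 + 2 * n + j * n" "R2 20 = j" "R2 2 = R' 2"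
      then show "runs (Block [Add 5 5 2]) (R2, M2) 1 (\<lambda>(R3, M3). R3 20 = j \<and> R3 2 = R' 2 \<and>
          M3 = M \<and> regs (R3(20 := Suc j, 21 := R' 2 - Suc j)) \<and>
          (R3(20 := Suc j, 21 := R' 2 - Suc j)) 5 = 2 + 2 * n + Suc j * n)"
        using R'2 by (intro runs_loop_free) (auto simp: regs_def)
    qed (use that in \<open>auto simp: regs_def work_def\<close>)
  qed
  let ?first = "Block [Const 31 1, Const 23 0, Load 2 23, Load 3 31, Const 4 k, Const 30 2, Add 29 30 2,
     Add 28 29 2, Add 14 3 31, Const 5 0, Add 5 5 28]"
  have "runs (For 20 2 21 (Block [Add 5 5 2]) ;; ?finish) (R', M) (n * 6 + 7) ?Q"
    if "regs R'" "R' 5 = 2 + 2 * n" for R'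
    by (rule runs_Seq_store[OF square[OF that]]) (use finish in auto)
  then have "runs ?first (R, M) 11 (\<lambda>s. runs (For 20 2 21 (Block [Add 5 5 2]) ;; ?finish) s (n * 6 + 7) ?Q)"
    using assms by (intro runs_loop_free[of "Block _"]) (auto simp: regs_def)
  then show ?thesis
    unfolding init_com_def by (rule runs_Seq) simp
qed

section \<open>Guesses as mixed-radix numbers\<close>

lemma rest_eq_div: "rest G t = G div (k * l) ^ t"
  by (induction t) (simp_all add: rest_Suc div_mult2_eq[symmetric] mult_ac)

text \<open>\<open>decode_Suc\<close> follows the machine, which extends the decoded part at its
  end; this form fits the induction over a given schedule.\<close>

lemma decode_Suc_front:
  "decode G (Suc t) = (G mod l, G div l mod k + 1) # decode (G div l div k) t"
proof -
  have "rest G (Suc i) = rest (G div l div k) i" for i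
    by (induction i) (simp_all add: rest_Suc)
  then show ?thesis
    by (simp add: decode_def upt_conv_Cons map_Suc_upt[symmetric] del: upt_Suc)
qed

lemma decode_valid: "l > 0 \<Longrightarrow> k > 0 \<Longrightarrow> \<forall>(i, c) \<in> set (decode G t). i < l \<and> 1 \<le> c \<and> c \<le> k"
  by (auto simp: decode_def Suc_le_eq)

lemma length_decode [simp]: "length (decode G t) = t"
  by (simp add: decode_def)

lemma decode_surj:
  assumes "\<forall>(i, c) \<in> set D. i < l \<and> 1 \<le> c \<and> c \<le> k"
  shows "\<exists>G < (k * l) ^ length D. decode G (length D) = D"
  using assms
proof (induction D)
  case (Cons d D)
  obtain i c where d: "d = (i, c)" by force
  obtain G where G: "G < (k * l) ^ length D" "decode G (length D) = D" using Cons by auto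
  \<comment> \<open>The Horner step that inverts decoding: the pair supplies the two lowest digits,
    with the colour shifted down by 1.\<close>
  define G' where "G' = i + l * ((c - 1) + k * G)"
  have ic: "i < l" "c - 1 < k" "c - 1 + 1 = c" using Cons.prems by (auto simp: d)
  have "G' mod l = i" "G' div l = (c - 1) + k * G" using ic(1) by (simp_all add: G'_def)
  moreover have "((c - 1) + k * G) mod k = c - 1" "((c - 1) + k * G) div k = G" using ic(2) by simp_all
  ultimately have "decode G' (length (d # D)) = d # D"
    using G(2) ic(3) by (simp add: decode_Suc_front d)
  moreover have "G' < (k * l) ^ length (d # D)"
  proof -
    have "(c - 1) + k * G < k * Suc G" using ic(2) by simp
    also have "\<dots> \<le> k * (k * l) ^ length D" using G(1) by (intro mult_left_mono) auto
    finally have "Suc ((c - 1) + k * G) \<le> k * (k * l) ^ length D" by simp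
    then have "l * Suc ((c - 1) + k * G) \<le> l * (k * (k * l) ^ length D)" by (intro mult_left_mono) auto
    moreover have "G' < l * Suc ((c - 1) + k * G)" using ic(1) by (simp add: G'_def)
    ultimately show ?thesis by (simp add: mult_ac)
  qed
  ultimately show ?case by blast
qed auto

section \<open>The search loop\<close>

abbreviation guesses :: nat where
  "guesses \<equiv> (k * l) ^ l"

text \<open>The end of the search shows only in a nonzero rest, so the surplus guess
  \<open>(k * l) ^ l\<close> is tried too, whence \<open>Suc guesses\<close>. It does no harm, since
  every number decodes to a valid schedule and acceptance is sound.\<close>

lemma runs_reconf_com:
  assumes "M 0 = n" "M 1 = l" "input M" "l > 0" "k > 0"
    "\<forall>u<n. 1 \<le> \<beta> u \<and> \<beta> u \<le> k \<and> (\<forall>w<n. adj u w \<longrightarrow> \<beta> u \<noteq> \<beta> w)"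
  shows "runs (reconf_com k) (R, M) (n * 6 + 19 + Suc guesses * (guess_time guesses + 2))
    (\<lambda>s. fst s 0 = of_bool reachable)"
proof -
  have reach: "reachable \<longleftrightarrow> (\<exists>G\<le>guesses. accepts (decode G l))"
  proof
    assume reachable
    moreover have "1 \<le> k" "1 \<le> l" using assms(4,5) by simp_all
    ultimately obtain D where D: "length D = l" "\<forall>(i, c) \<in> set D. i < l \<and> 1 \<le> c \<and> c \<le> k" "accepts D"
      using reachable_iff_accepts[OF assms(6)] by blast
    obtain G where "G < (k * l) ^ length D" "decode G (length D) = D"
      using decode_surj[OF D(2)] by blast
    then show "\<exists>G\<le>guesses. accepts (decode G l)"
      using D(1,3) by (intro exI[of _ G]) simp
  next
    assume "\<exists>G\<le>guesses. accepts (decode G l)"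
    then obtain G where "accepts (decode G l)" by blast
    then show reachable
      using decode_valid[OF assms(4,5), of G l] by (intro accepts_sound[of "decode G l"]) auto
  qed
  \<comment> \<open>When the loop is about to stop, register 0 must hold the answer; while it runs,
    it is enough that all smaller guesses failed.\<close>
  define J where "J m s \<longleftrightarrow> base (fst s) \<and> input (snd s) \<and> m = Suc guesses - fst s 8 \<and>
    (if fst s 26 = 0 then fst s 0 = of_bool reachable
     else fst s 8 \<le> guesses \<and> (\<forall>G<fst s 8. \<not> accepts (decode G l)))" for m and s :: store
  have loop: "runs (While_Nonzero 26 guess_com) (R', M) (Suc guesses * (guess_time guesses + 2) + 1)
      (\<lambda>s. fst s 0 = of_bool reachable)" if "base R'" "R' 8 = 0" "R' 26 = 1" for R'
  proof (rule runs_While[where J = J])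
    show "J (Suc guesses) (R', M)" using that assms(3) by (simp add: J_def)
  next
    fix m and s :: store assume J: "J m s" "fst s 26 \<noteq> 0"
    obtain R1 M1 where s: "s = (R1, M1)" by force
    have R1: "base R1" "input M1" "m = Suc guesses - R1 8" "R1 8 \<le> guesses" "\<forall>G<R1 8. \<not> accepts (decode G l)"
      using J by (simp_all add: J_def s)
    show "runs guess_com s (guess_time guesses) (\<lambda>s'. \<exists>m'<m. J m' s')"
      unfolding s
    proof (rule runs_weaken_store[OF runs_guess_com[OF R1(1,2) assms(4,5)]])
      show "guess_time (R1 8) \<le> guess_time guesses"
        unfolding guess_time_def pass_time_def using R1(4)
        by (intro add_le_mono1 mult_le_mono2 mult_le_mono le_refl)
      fix R2 M2
      assume *: "base R2 \<and> input M2 \<and> R2 8 = Suc (R1 8) \<and> R2 0 = of_bool (accepts (decode (R1 8) l)) \<and>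
        R2 26 = 1 - of_bool (accepts (decode (R1 8) l)) - rest (R1 8) l"
      have "J (Suc guesses - R2 8) (R2, M2)"
      proof (cases "accepts (decode (R1 8) l)")
        case True
        then show ?thesis using * R1(4) reach by (auto simp: J_def)
      next
        case False
        show ?thesis
        proof (cases "R1 8 = guesses")
          case True
          have "\<not> reachable"
            unfolding reach using True R1(5) False by (metis le_neq_implies_less)
          \<comment> \<open>The surplus guess leaves rest 1, which stops the loop with the negative
            verdict in register 0.\<close>
          moreover have "rest (R1 8) l = 1" using True assms(4,5) by (simp add: rest_eq_div)
          ultimately show ?thesis using * by (simp add: J_def False)
        next
          case less: False
          then have "rest (R1 8) l = 0" using R1(4) by (simp add: rest_eq_div)
          then show ?thesis using * False less R1(4,5) by (auto simp: J_def less_Suc_eq)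
        qed
      qed
      moreover have "Suc guesses - R2 8 < m" using * R1(3,4) by simp
      ultimately show "\<exists>m'<m. J m' (R2, M2)" by blast
    qed
  next
    fix m and s :: store assume "J m s" "fst s 26 = 0"
    then show "fst s 0 = of_bool reachable" by (simp add: J_def)
  qed
  show ?thesis
    unfolding reconf_com_def
  proof (rule runs_Seq_store[OF runs_init_com[of M R, OF assms(1,2)]])
    fix R' M' assume *: "M' = M \<and> base R' \<and> R' 8 = 0 \<and> R' 26 = 1"
    then show "runs (While_Nonzero 26 guess_com) (R', M') (Suc guesses * (guess_time guesses + 2) + 1)
      (\<lambda>s. fst s 0 = of_bool reachable)" using loop[of R'] by simp
  next
    show "(n * 6 + 18) + (Suc guesses * (guess_time guesses + 2) + 1) \<le>
      n * 6 + 19 + Suc guesses * (guess_time guesses + 2)" by linarith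
  qed
qed

end

lemma safe_reconf_com: "safe (reconf_com k)"
  by (simp add: reconf_com_def init_com_def guess_com_def pass_com_def step_com_def decode_com_def
      divide_def recolour_com_def mark_all_def mark_com_def conflict_test_def target_test_def)

section \<open>Walks in the reconfiguration graph\<close>

text \<open>Cutting out cycles only shortens a walk. An instance asks for a path, whereas a legal
  sequence may revisit colourings.\<close>

lemma (in wf_digraph) awalk_imp_apath:
  assumes "awalk u p v"
  shows "\<exists>q. apath u q v \<and> length q \<le> length p"
  using assms
proof (induct rule: awalk_to_apath_induct)
  case (path p)
  then show ?case by (auto simp: apath_def)
next
  case (decomp p q r s)
  then have "p = q @ r @ s" by (auto elim!: awalk_cyc_decompE)
  then show ?case using decomp by fastforce
qed

locale reconf_problem =
  fixes k :: nat and I :: reconf_instance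
  assumes I: "I \<in> reconf_instances k"
begin

abbreviation adjacent :: "nat \<Rightarrow> nat \<Rightarrow> bool" where
  "adjacent u w \<equiv> (u, w) \<in> parcs (graph I)"

sublocale recolouring "num_vertices I" k "bound I" adjacent "source I" "target I" .

sublocale G: pair_graph "graph I"
  using I by (simp add: reconf_instances_def)

sublocale W: pair_graph "reconf_graph k (graph I)"
  by (rule pair_graph_reconf_graph) (rule G.pair_graph_axioms)

lemma pverts_graph: "pverts (graph I) = {0..<num_vertices I}"
  using I unfolding reconf_instances_def by blast

lemma proper_source: "source I \<in> proper_colourings k (graph I)"
  and proper_target: "target I \<in> proper_colourings k (graph I)"
  and bound_pos: "1 \<le> bound I"
  using I by (simp_all add: reconf_instances_def)

lemma adjacent_sym: "adjacent u w \<longleftrightarrow> adjacent w u"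
  using G.pair_sym_arcs by (auto simp: symmetric_def dest: symD)

lemma adjacent_less: "adjacent u w \<Longrightarrow> u < num_vertices I \<and> w < num_vertices I \<and> u \<noteq> w"
  using G.arc_fst_in_verts[of "(u, w)"] G.arc_snd_in_verts[of "(u, w)"] G.pair_no_loops[of "(u, w)"]
  by (auto simp: pverts_graph)

lemma proper_colouringsD:
  assumes "c \<in> proper_colourings k (graph I)"
  shows "c \<in> extensional {0..<num_vertices I}" "u < num_vertices I \<Longrightarrow> 1 \<le> c u \<and> c u \<le> k"
    "adjacent u w \<Longrightarrow> c u \<noteq> c w"
  using assms by (auto simp: proper_colourings_def colourings_def pverts_graph PiE_def Pi_iff)

text \<open>Neighbours of \<open>v\<close> have the same colour in \<open>c\<close> and
  \<open>d\<close>, so the neighbour test of the move is properness of \<open>d\<close>.\<close>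

lemma arc_recolour:
  assumes "(c, d) \<in> parcs (reconf_graph k (graph I))"
  shows "\<exists>v. d = c(v := d v) \<and> legal c [(v, d v)]"
proof -
  have c: "c \<in> proper_colourings k (graph I)" and d: "d \<in> proper_colourings k (graph I)"
    and "\<exists>!v. v < num_vertices I \<and> c v \<noteq> d v"
    using assms by (auto simp: reconf_graph_def pverts_graph)
  then obtain v where v: "v < num_vertices I" "\<And>w. w < num_vertices I \<Longrightarrow> w \<noteq> v \<Longrightarrow> c w = d w"
    by metis
  have "d = c(v := d v)"
  proof
    fix w show "d w = (c(v := d v)) w"
      using v proper_colouringsD(1)[OF c] proper_colouringsD(1)[OF d]
      by (cases "w < num_vertices I") (auto simp: extensional_def)
  qed
  moreover have "c w \<noteq> d v" if "adjacent v w" for w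
    using proper_colouringsD(3)[OF d that] v(2)[of w] adjacent_less[OF that] by simp
  ultimately show ?thesis
    using v(1) proper_colouringsD(2)[OF d] by auto
qed

lemma awalk_legal:
  assumes "W.awalk c p d"
  shows "\<exists>ys. length ys = length p \<and> legal c ys \<and> recolour c ys = d"
  using assms
proof (induction p arbitrary: c)
  case Nil
  then show ?case by (auto simp: W.awalk_simps)
next
  case (Cons e p)
  obtain c' where e: "e = (c, c')" "(c, c') \<in> parcs (reconf_graph k (graph I))" "W.awalk c' p d"
    using Cons.prems by (cases e) (auto simp: W.awalk_simps)
  obtain v where v: "c' = c(v := c' v)" "legal c [(v, c' v)]"
    using arc_recolour[OF e(2)] by blast
  obtain ys where ys: "length ys = length p" "legal c' ys" "recolour c' ys = d"
    using Cons.IH[OF e(3)] by blast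
  have "recolour c ((v, c' v) # ys) = d" "legal c ((v, c' v) # ys)"
    using ys(2,3) v by (simp_all flip: v(1))
  then show ?case using ys(1) by (intro exI[of _ "(v, c' v) # ys"]) simp
qed

text \<open>A move that keeps the colour of its vertex is not an arc and is dropped, so the walk may
  be shorter than the sequence.\<close>

lemma legal_awalk:
  assumes "c \<in> proper_colourings k (graph I)" "legal c ys"
  shows "\<exists>p. length p \<le> length ys \<and> W.awalk c p (recolour c ys)"
  using assms
proof (induction ys arbitrary: c)
  case Nil
  then have "c \<in> pverts (reconf_graph k (graph I))" by (simp add: reconf_graph_def)
  then show ?case by (auto simp: W.awalk_simps)
next
  case (Cons a ys)
  obtain y x where a: "a = (y, x)" by force
  define c' where "c' = c(y := x)"
  have y: "y < num_vertices I" "1 \<le> x" "x \<le> k" "\<forall>w<num_vertices I. adjacent y w \<longrightarrow> c w \<noteq> x" "legal c' ys"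
    using Cons.prems(2) by (auto simp: a c'_def)
  have "c' u \<noteq> c' w" if "adjacent u w" for u w
    using proper_colouringsD(3)[OF Cons.prems(1) that] y(4) adjacent_less[OF that] that adjacent_sym[of u w]
    by (auto simp: c'_def)
  moreover have "c' \<in> colourings k (graph I)"
    using Cons.prems(1) y(1-3) by (auto simp: proper_colourings_def colourings_def pverts_graph PiE_def c'_def
        extensional_def)
  ultimately have c': "c' \<in> proper_colourings k (graph I)" by (auto simp: proper_colourings_def)
  then obtain p where p: "length p \<le> length ys" "W.awalk c' p (recolour c' ys)"
    using Cons.IH y(5) by blast
  show ?case
  proof (cases "c y = x")
    case True
    then have "c' = c" by (auto simp: c'_def)
    then show ?thesis using p by (intro exI[of _ p]) (auto simp: a c'_def)
  next
    case False
    then have "(c, c') \<in> parcs (reconf_graph k (graph I))"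
      using Cons.prems(1) c' y(1) by (auto simp: reconf_graph_def pverts_graph c'_def)
    then have "W.awalk c ((c, c') # p) (recolour c' ys)"
      using p(2) by (simp add: W.awalk_simps)
    then show ?thesis
      using p(1) by (intro exI[of _ "(c, c') # p"]) (simp add: a c'_def)
  qed
qed

lemma reconf_yes_iff: "reconf_yes k I \<longleftrightarrow> reachable"
proof
  assume "reconf_yes k I"
  then obtain p where "W.awalk (source I) p (target I)" "length p \<le> bound I"
    by (auto simp: reconf_yes_def W.apath_def)
  then show reachable
    using awalk_legal[of "source I" p "target I"] unfolding reachable_def by metis
next
  assume reachable
  then obtain ys where ys: "length ys \<le> bound I" "legal (source I) ys"
    "\<forall>w<num_vertices I. recolour (source I) ys w = target I w"
    unfolding reachable_def by blast
  obtain p where p: "length p \<le> length ys" "W.awalk (source I) p (recolour (source I) ys)"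
    using legal_awalk[OF proper_source ys(2)] by blast
  \<comment> \<open>This supplies extensionality, which turns agreement with the target on the
    vertices into equality of functions.\<close>
  have "recolour (source I) ys \<in> proper_colourings k (graph I)"
    using W.awalk_last_in_verts[OF p(2)] by (simp add: reconf_graph_def)
  then have "recolour (source I) ys = target I"
    using ys(3) proper_colouringsD(1)[OF proper_target] proper_colouringsD(1)
    by (intro extensionalityI[of _ "{0..<num_vertices I}"]) auto
  then obtain q where "W.apath (source I) q (target I)" "length q \<le> length p"
    using W.awalk_imp_apath p(2) by metis
  then show "reconf_yes k I"
    using p(1) ys(1) unfolding reconf_yes_def by (meson le_trans)
qed

abbreviation memory :: "nat \<Rightarrow> nat" where
  "memory \<equiv> \<lambda>i. if i < length (reconf_encode I) then reconf_encode I ! i else 0"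

lemma memory_input: "input memory"
proof -
  let ?n = "num_vertices I"
  have len: "length (concat (map (\<lambda>u. map (f u) [0..<?n]) [0..<m])) = m * ?n" for m and f :: "nat \<Rightarrow> nat \<Rightarrow> nat"
    by (induction m) auto
  have row: "concat (map (\<lambda>u. map (f u) [0..<?n]) [0..<m]) ! (w + u * ?n) = f u w"
    if "u < m" "w < ?n" for u w m and f :: "nat \<Rightarrow> nat \<Rightarrow> nat"
    using that
  proof (induction m)
    case (Suc m)
    show ?case
    proof (cases "u = m")
      case True
      then show ?thesis using Suc.prems len by (simp add: nth_append)
    next
      case False
      then have "u < m" using Suc.prems by simp
      have "w + u * ?n < Suc u * ?n" using Suc.prems by simp
      also have "\<dots> \<le> m * ?n" using \<open>u < m\<close> by (intro mult_le_mono1) simp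
      finally show ?thesis using Suc.IH[OF \<open>u < m\<close>] Suc.prems(2) len by (simp add: nth_append)
    qed
  qed simp
  have in_range: "u + w * ?n < ?n * ?n" if "u < ?n" "w < ?n" for u w
  proof -
    have "u + w * ?n < Suc w * ?n" using that by simp
    also have "\<dots> \<le> ?n * ?n" using that by (intro mult_le_mono1) simp
    finally show ?thesis .
  qed
  have "memory (2 + w) = source I w" "memory (2 + ?n + w) = target I w" if "w < ?n" for w
    using that len by (simp_all add: reconf_encode_def nth_append)
  \<comment> \<open>The encoding stores \<open>adjacent w u\<close> at this place; symmetry of the
    graph exchanges the two vertices.\<close>
  moreover have "memory (2 + 2 * ?n + u + w * ?n) = of_bool (adjacent u w)" if "u < ?n" "w < ?n" for u w
    using that len row[of w ?n u "\<lambda>u v. if (u, v) \<in> parcs (graph I) then 1 else 0"] in_range[OF that]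
      adjacent_sym[of u w]
    by (simp add: reconf_encode_def nth_append)
  ultimately show ?thesis by (simp add: input_def)
qed

lemma reconf_com_outputs:
  assumes "k > 0"
  shows "outputs_within (compile 0 (reconf_com k)) (reconf_encode I) (if reconf_yes k I then 1 else 0)
    (num_vertices I * 6 + 19 + Suc guesses * (guess_time guesses + 2))"
proof (rule outputs_withinI[OF _ safe_reconf_com])
  have "memory 0 = num_vertices I" "memory 1 = bound I"
    by (simp_all add: reconf_encode_def)
  then show "runs (reconf_com k) (\<lambda>_. 0, memory)
      (num_vertices I * 6 + 19 + Suc guesses * (guess_time guesses + 2))
      (\<lambda>s. fst s 0 = (if reconf_yes k I then 1 else 0))"
    using runs_reconf_com[OF _ _ memory_input, of "\<lambda>_. 0"] bound_pos assms reconf_yes_iff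
      proper_colouringsD(2,3)[OF proper_target]
    by (simp add: of_bool_def)
qed

end

section \<open>Time bounds\<close>

definition reconf_time :: "nat \<Rightarrow> nat \<Rightarrow> nat \<Rightarrow> nat" where
  "reconf_time k n l =
     n * 6 + 19 + Suc ((k * l) ^ l) * (recolouring.guess_time n l ((k * l) ^ l) + 2)"

lemma reconf_com_solves:
  assumes "k > 0"
  shows "solves_in_time (compile 0 (reconf_com k)) (colouring_reconfiguration k)
    (\<lambda>I. reconf_time k (num_vertices I) (bound I))"
  unfolding solves_in_time_def
proof
  fix I assume "I \<in> instances (colouring_reconfiguration k)"
  then interpret reconf_problem k I
    by unfold_locales (simp add: colouring_reconfiguration_def)
  show "outputs_within (compile 0 (reconf_com k)) (encode (colouring_reconfiguration k) I)
      (if yes (colouring_reconfiguration k) I then 1 else 0) (reconf_time k (num_vertices I) (bound I))"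
    using reconf_com_outputs[OF assms] by (simp add: colouring_reconfiguration_def reconf_time_def)
qed

text \<open>One factor \<open>N\<close> counts the guesses and one pays for decoding a guess;
  \<open>l * l\<close> stems from the \<open>l + 1\<close> passes over \<open>l\<close> entries, and
  \<open>n\<close> from the scan of one matrix column per entry.\<close>

lemma reconf_time_le:
  assumes "k \<ge> 1" "n \<ge> 1" "l \<ge> 1"
  shows "reconf_time k n l \<le> 527 * (((k * l) ^ l)\<^sup>2 * (l\<^sup>2 * n))"
proof -
  define N where "N = (k * l) ^ l"
  have N: "N \<ge> 1" using assms by (simp add: N_def)
  define X where "X = N * (l * n)"
  define Y where "Y = l * X"
  have le: "l * (l * n) \<le> Y" "n \<le> l * n" "1 \<le> l * n"
    using assms N by (simp_all add: X_def Y_def)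
  have X: "l * N \<le> X" "l * n \<le> X" "l \<le> X" "n \<le> X" "1 \<le> X"
    using assms N by (simp_all add: X_def)
  have "recolouring.pass_time n l N = 12 * (l * N) + 23 * (l * n) + 30 * l + 32 * n + 12"
    by (simp add: recolouring.pass_time_def algebra_simps)
  \<comment> \<open>Every summand is at most its coefficient times \<open>X\<close>, and 109 = 12 +
    23 + 30 + 32 + 12.\<close>
  then have pass: "recolouring.pass_time n l N \<le> 109 * X" using X by linarith
  have XY: "X \<le> Y" "1 \<le> Y" using assms X by (simp_all add: Y_def)
  have "Suc l * (recolouring.pass_time n l N + 5) \<le> (2 * l) * (114 * X)"
    using pass X(5) assms(3) by (intro mult_le_mono) auto
  also have "\<dots> = 228 * Y" by (simp add: Y_def)
  finally have guess: "recolouring.guess_time n l N + 2 \<le> 251 * Y"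
    using X XY by (simp add: recolouring.guess_time_def)
  have "Suc N * (recolouring.guess_time n l N + 2) \<le> (2 * N) * (251 * Y)"
    using guess N by (intro mult_le_mono) auto
  moreover have "n * 6 + 19 \<le> 25 * (N * Y)"
  proof -
    have "Y \<le> N * Y" using N by simp
    then show ?thesis using X XY by linarith
  qed
  \<comment> \<open>Here 251 = 2 * 114 + 8 + 13 + 2 and 527 = 2 * 251 + 25.\<close>
  ultimately have "reconf_time k n l \<le> 527 * (N * Y)"
    unfolding reconf_time_def N_def[symmetric] by simp
  also have "N * Y = N\<^sup>2 * (l\<^sup>2 * n)" by (simp add: X_def Y_def power2_eq_square)
  finally show ?thesis by (simp add: N_def)
qed

lemma reconf_time_bound:
  assumes "k \<ge> 1" "n \<ge> 1" "l \<ge> 1"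
  shows "reconf_time k n l \<le> 527 * ((k * l) ^ (l\<^sup>2 + l) * (l * n\<^sup>2))"
proof -
  have "((k * l) ^ l)\<^sup>2 * l \<le> (k * l) ^ (l\<^sup>2 + l)"
  \<comment> \<open>For \<open>l \<ge> 2\<close> the surplus factor \<open>l\<close> is absorbed by
    one more power of \<open>k * l\<close>, as \<open>2 * l + 1 \<le> l * l + l\<close>. For
    \<open>l = 1\<close> this inequality fails, but the surplus factor is 1 and both exponents are
    2.\<close>
  proof (cases "l = 1")
    case True
    then show ?thesis by (simp add: power2_eq_square)
  next
    case False
    then have "Suc l \<le> l * l" using assms(3) mult_le_mono1[of 2 l l] by linarith
    then have "2 * l + 1 \<le> l\<^sup>2 + l" by (simp add: power2_eq_square)
    then have "(k * l) ^ (2 * l + 1) \<le> (k * l) ^ (l\<^sup>2 + l)"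
      using assms by (intro power_increasing) auto
    moreover have "((k * l) ^ l)\<^sup>2 * l \<le> (k * l) ^ (2 * l) * (k * l)"
      using assms(1) by (intro mult_le_mono) (simp_all add: power_mult[symmetric] mult.commute)
    moreover have "(k * l) ^ (2 * l + 1) = (k * l) ^ (2 * l) * (k * l)"
      by (simp only: power_add power_one_right)
    ultimately show ?thesis by linarith
  qed
  moreover have "n \<le> n\<^sup>2" using assms(2) by (simp add: power2_eq_square)
  ultimately have "((k * l) ^ l)\<^sup>2 * l * (l * n) \<le> (k * l) ^ (l\<^sup>2 + l) * (l * n\<^sup>2)"
    by (intro mult_le_mono) auto
  moreover have "((k * l) ^ l)\<^sup>2 * l * (l * n) = ((k * l) ^ l)\<^sup>2 * (l\<^sup>2 * n)"
    by (simp add: power2_eq_square)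
  ultimately show ?thesis
    using reconf_time_le[OF assms] by linarith
qed

text \<open>Extends the bound for \<open>n \<ge> 1\<close> to the empty graph, which is an instance
  too.\<close>

lemma reconf_time_Suc: "reconf_time k n l \<le> reconf_time k (Suc n) l"
  unfolding reconf_time_def recolouring.guess_time_def recolouring.pass_time_def
  by (intro add_le_mono mult_le_mono) auto

section \<open>A computable parameter bound\<close>

lemma square_le_four_power: "(l::nat)\<^sup>2 \<le> 4 ^ l"
proof -
  have "l\<^sup>2 \<le> (2 ^ l)\<^sup>2" by (intro power_mono) (simp_all add: less_imp_le)
  also have "\<dots> = (2\<^sup>2) ^ l" by (simp only: power_mult[symmetric] mult.commute)
  finally show ?thesis by simp
qed

text \<open>A double exponential is chosen because repeated doubling computes it without
  multiplication. In the exponent, 14 = 10 + 2 + 2 collects \<open>527 \<le> 2 ^ 10\<close> and the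
  terms \<open>2 * (l * l)\<close> and \<open>2 * l\<close>, with \<open>l * l\<close> and
  \<open>l\<close> both at most \<open>4 ^ l\<close>.\<close>

lemma parameter_bound:
  "527 * (((k * l) ^ l)\<^sup>2 * l\<^sup>2) \<le> (2::nat) ^ ((14 + 2 * k) * 4 ^ l)"
proof -
  have two: "m \<le> 2 ^ m" for m :: nat by (simp add: less_imp_le)
  have "k * l \<le> 2 ^ (k + l)" using mult_le_mono[OF two[of k] two[of l]] by (simp add: power_add)
  then have "((k * l) ^ l)\<^sup>2 \<le> ((2 ^ (k + l)) ^ l)\<^sup>2" by (intro power_mono) auto
  also have "\<dots> = 2 ^ (2 * (k + l) * l)" by (simp add: power_mult[symmetric] mult_ac)
  finally have "((k * l) ^ l)\<^sup>2 \<le> 2 ^ (2 * (k + l) * l)" .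
  moreover have "l\<^sup>2 \<le> (2 ^ l)\<^sup>2" by (intro power_mono two) simp
  then have "l\<^sup>2 \<le> 2 ^ (2 * l)" by (simp add: power_mult[symmetric] mult.commute)
  ultimately have "527 * (((k * l) ^ l)\<^sup>2 * l\<^sup>2) \<le> 2 ^ 10 * (2 ^ (2 * (k + l) * l) * 2 ^ (2 * l))"
    by (intro mult_le_mono) auto
  also have "\<dots> = 2 ^ (10 + 2 * (k + l) * l + 2 * l)" by (simp only: power_add mult.assoc)
  also have "\<dots> \<le> 2 ^ ((14 + 2 * k) * 4 ^ l)"
  proof (rule power_increasing)
    have sq: "l * l \<le> 4 ^ l" using square_le_four_power[of l] by (simp add: power2_eq_square)
    have "l \<le> l * l" by simp
    then have "l \<le> 4 ^ l" using sq by linarith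
    moreover have "k * l \<le> k * 4 ^ l" using calculation by (intro mult_le_mono2)
    moreover have "1 \<le> (4::nat) ^ l" by simp
    moreover have "10 + 2 * (k + l) * l + 2 * l = 10 + 2 * (k * l) + 2 * (l * l) + 2 * l"
      "(14 + 2 * k) * 4 ^ l = 14 * 4 ^ l + 2 * (k * 4 ^ l)" by (simp_all add: algebra_simps)
    ultimately show "10 + 2 * (k + l) * l + 2 * l \<le> (14 + 2 * k) * 4 ^ l" using sq by linarith
  qed simp
  finally show ?thesis .
qed

definition double_exp_com :: "nat \<Rightarrow> com" where
  "double_exp_com c = Block [Const 2 0, Load 3 2, Const 4 c] ;; For 5 3 6 (Block [Add 4 4 4, Add 4 4 4]) ;;
     Block [Const 0 1] ;; For 5 4 6 (Block [Add 0 0 0])"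

lemma computable_double_exp: "computable (\<lambda>l. 2 ^ (c * 4 ^ l))"
  unfolding computable_def
proof (intro exI allI)
  fix l :: nat
  let ?T = "l * 7 + 10 + (c * 4 ^ l) * 6"
  let ?Q = "\<lambda>s::store. fst s 0 = 2 ^ (c * 4 ^ l)"
  have second: "runs (For 5 4 6 (Block [Add 0 0 0])) (R, M) ((c * 4 ^ l) * 6 + 3) ?Q"
    if "R 0 = 1" "R 4 = c * 4 ^ l" for R M
    by (rule runs_For[where J = "\<lambda>j R M. R 0 = 2 ^ j" and T = 1])
      (use that in \<open>auto intro!: runs_loop_free\<close>)
  have first: "runs (For 5 3 6 (Block [Add 4 4 4, Add 4 4 4])) (R, M) (l * 7 + 3)
      (\<lambda>(R, M). R 4 = c * 4 ^ l)" if "R 3 = l" "R 4 = c" for R M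
    by (rule runs_For[where J = "\<lambda>j R M. R 4 = c * 4 ^ j" and T = 2])
      (use that in \<open>auto intro!: runs_loop_free\<close>)
  have third: "runs (Block [Const 0 1] ;; For 5 4 6 (Block [Add 0 0 0])) (R, M) ((c * 4 ^ l) * 6 + 4) ?Q"
    if "R 4 = c * 4 ^ l" for R M
  proof (rule runs_Seq)
    show "runs (Block [Const 0 1]) (R, M) 1
        (\<lambda>s. runs (For 5 4 6 (Block [Add 0 0 0])) s ((c * 4 ^ l) * 6 + 3) ?Q)"
      by (rule runs_loop_free) (simp_all add: second that)
  qed simp
  have fourth: "runs (For 5 3 6 (Block [Add 4 4 4, Add 4 4 4]) ;; Block [Const 0 1] ;;
      For 5 4 6 (Block [Add 0 0 0])) (R, M) (l * 7 + 7 + (c * 4 ^ l) * 6) ?Q" if "R 3 = l" "R 4 = c" for R M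
    by (rule runs_Seq_store[OF first[OF that] third]) simp_all
  have "runs (double_exp_com c) (\<lambda>_. 0, \<lambda>i. if i < length [l] then [l] ! i else 0) ?T ?Q"
    unfolding double_exp_com_def
  proof (rule runs_Seq)
    show "runs (Block [Const 2 0, Load 3 2, Const 4 c]) (\<lambda>_. 0, \<lambda>i. if i < length [l] then [l] ! i else 0) 3
      (\<lambda>s. runs (For 5 3 6 (Block [Add 4 4 4, Add 4 4 4]) ;; Block [Const 0 1] ;;
        For 5 4 6 (Block [Add 0 0 0])) s (l * 7 + 7 + (c * 4 ^ l) * 6) ?Q)"
      by (rule runs_loop_free) (simp_all add: fourth del: One_nat_def)
  qed simp
  then show "outputs_within (compile 0 (double_exp_com c)) [l] (2 ^ (c * 4 ^ l)) ?T"
    by (rule outputs_withinI) (simp add: double_exp_com_def)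
qed

lemma Suc_num_vertices_le_input_size: "Suc (num_vertices I) \<le> input_size (reconf_encode I)"
proof -
  have "length xs \<le> input_size xs" for xs
    by (induction xs) (auto simp: input_size_def)
  moreover have "Suc (num_vertices I) \<le> length (reconf_encode I)" by (simp add: reconf_encode_def)
  ultimately show ?thesis using le_trans by blast
qed

lemma solves_in_time_mono:
  assumes "solves_in_time P Q T" "\<And>I. I \<in> instances Q \<Longrightarrow> T I \<le> T' I"
  shows "solves_in_time P Q T'"
  using assms outputs_within_mono unfolding solves_in_time_def by blast

lemma colouring_reconfiguration_fpt:
  assumes "k \<ge> 1"
  shows "fixed_parameter_tractable (colouring_reconfiguration k)"
proof -
  let ?f = "\<lambda>l. 2 ^ ((14 + 2 * k) * 4 ^ l) :: nat"
  have "solves_in_time (compile 0 (reconf_com k)) (colouring_reconfiguration k)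
    (\<lambda>I. ?f (parameter (colouring_reconfiguration k) I) *
      input_size (encode (colouring_reconfiguration k) I) ^ 1)"
  proof (rule solves_in_time_mono[OF reconf_com_solves])
    fix I assume "I \<in> instances (colouring_reconfiguration k)"
    then have l: "bound I \<ge> 1" by (simp add: colouring_reconfiguration_def reconf_instances_def)
    let ?n = "num_vertices I" and ?l = "bound I"
    have "reconf_time k ?n ?l \<le> 527 * (((k * ?l) ^ ?l)\<^sup>2 * (?l\<^sup>2 * Suc ?n))"
      using reconf_time_Suc[of k ?n ?l] reconf_time_le[OF assms _ l, of "Suc ?n"] by linarith
    also have "\<dots> = 527 * (((k * ?l) ^ ?l)\<^sup>2 * ?l\<^sup>2) * Suc ?n" by (simp only: mult.assoc)
    also have "\<dots> \<le> ?f ?l * input_size (reconf_encode I)"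
      by (intro mult_le_mono parameter_bound Suc_num_vertices_le_input_size)
    finally show "reconf_time k ?n ?l \<le> ?f (parameter (colouring_reconfiguration k) I) *
        input_size (encode (colouring_reconfiguration k) I) ^ 1"
      by (simp add: colouring_reconfiguration_def)
  qed (use assms in simp)
  then show ?thesis
    unfolding fixed_parameter_tractable_def using computable_double_exp by blast
qed

theorem theorem2:
  fixes k :: nat
  assumes "k \<ge> 4"
  shows "(\<exists>P T. solves_in_time P (colouring_reconfiguration k) (\<lambda>I. T (num_vertices I) (bound I)) \<and>
            (\<exists>C. \<forall>n\<ge>1. \<forall>l\<ge>1. T n l \<le> C * ((k * l) ^ (l\<^sup>2 + l) * (l * n\<^sup>2)))) \<and>
         fixed_parameter_tractable (colouring_reconfiguration k)"
proof (intro conjI exI)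
  show "solves_in_time (compile 0 (reconf_com k)) (colouring_reconfiguration k)
    (\<lambda>I. reconf_time k (num_vertices I) (bound I))"
    using assms by (intro reconf_com_solves) simp
  show "\<forall>n\<ge>1. \<forall>l\<ge>1. reconf_time k n l \<le> 527 * ((k * l) ^ (l\<^sup>2 + l) * (l * n\<^sup>2))"
    using assms reconf_time_bound[of k] by simp
  show "fixed_parameter_tractable (colouring_reconfiguration k)"
    using assms by (intro colouring_reconfiguration_fpt) simp
qed

end
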